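(* Let $B$ be an infinite set, $b=|B|$, and let $E$ be an exact lim-rim over $B$ with ultrafilter $\mathcal L$. For every set or class $X$ let ${}^*X$ be the set or class of non-standard elements of $X$ given by the cylindrical ultrapower with respect to $\mathcal L$. Then: (a) (Transfer) For any sets or classes $X_1,\dots,X_r$ and any relations among them, every many-sorted first-order sentence (with equality) in these relations which is true for the $X_j$ is true for the ${}^*X_j$ when each relation $R$ is replaced by ${}^*R$. (b) ($b^+$-confinement) For every set or class $X$, every element of ${}^*X$ belongs to ${}^*A$ for some set $A\subset X$ with $|A|\le b$. (c) If $m\le b^+$ is a cardinal and $E$ is $m$-saturated, then for every set or class $X$, every family of fewer than $m$ internal subsets of ${}^*X$, all of whose finite subfamilies have non-empty intersection, has non-empty intersection. If moreover $E$ is a regular lim-rim with basis $B$, then: (d) the conclusion of (c) holds with $m=b^+$ for every set or class $X$, and with $m=(2^b)^+$ for every set $X$ with $|X|\le b$; (e) $|{}^*X|=2^{2^b}$ for every infinite set $X$ with $|X|\le 2^{2^b}$; and for every infinite cardinal $b'<b$, there are among the elements of ${}^*X$ $2^{2^b}$ elements with the better confinement $b'$.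
   Context: $m^+$ denotes the successor cardinal of $m$. For sets $B,E$, a cylinder of $B^E$ is a subset of the form $\{\psi\in B^E:\psi|_J\in R\}$ with $J\subset E$ finite and $R\subset B^J$; the cylinders form a Boolean algebra. A lim-rim over $B$ is a set $E$ together with an ultrafilter $\mathcal L$ in the cylinder Boolean algebra of $B^E$. For $R\subset B^n$ put $R^E=\{(e_1,\dots,e_n)\in E^n:\{\psi\in B^E:(\psi_{e_1},\dots,\psi_{e_n})\in R\}\in\mathcal L\}$. The lim-rim is separated if $\{\psi:\psi_e=\psi_{e'}\}\in\mathcal L$ implies $e=e'$. For $\eta:I\to E$, let $\mathcal L_\eta$ be the ultrafilter in the cylinder algebra of $B^I$ consisting of the cylinders $C$ with $\{\psi\in B^E:\psi\circ\eta\in C\}\in\mathcal L$. For a cardinal $m$, $E$ is $m$-exact if for every set $I$ with $|I|<m$, every $i\notin I$, every $\eta:I\to E$, and every ultrafilter $\mathcal U$ in the cylinder algebra of $B^{I\cup\{i\}}$ whose projection to $B^I$ equals $\mathcal L_\eta$, there is an extension $\eta':I\cup\{i\}\to E$ of $\eta$ with $\mathcal L_{\eta'}=\mathcal U$. $E$ is exact if it is separated and $\aleph_0$-exact. $E$ is $m$-saturated if for every $n$, every family of fewer than $m$ sets of the form $\{x\in E^n:(x,e)\in R^E\}$ ($R\subset B^{n+1}$, $e\in E$) all of whose finite subfamilies have non-empty intersection has non-empty intersection. A regular lim-rim with basis $B$ is a separated lim-rim over $B$ of cardinality $2^{2^{|B|}}$ which is $(2^{|B|})^+$-exact. Cylindrical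 ultrapower: for a set $X$, ${}^*X$ is the set of maps $f:B^E\to X$ depending only on finitely many coordinates, modulo the equivalence $f\sim g\iff\{\psi\in B^E:f(\psi)=g(\psi)\}\in\mathcal L$. For $A\subset X$, ${}^*A$ is regarded as a subset of ${}^*X$; for a class $X$, ${}^*X$ is the direct limit of the ${}^*A$ over all sets $A\subset X$. For a relation $R\subset X_1\times\dots\times X_k$ (set or class), ${}^*R\subset{}^*X_1\times\dots\times{}^*X_k$ consists of the $([f_1],\dots,[f_k])$ with $\{\psi:(f_1(\psi),\dots,f_k(\psi))\in R\}\in\mathcal L$. An internal subset of ${}^*X$ is one of the form $\{x\in{}^*X:(x,y)\in{}^*R\}$ for some set $Y$, some set $R\subset X\times Y$ and some $y\in{}^*Y$. For a cardinal $m$, a non-standard element has confinement $m$ if it belongs to ${}^*A$ for some (standard) set $A$ of cardinality $<m$.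
   Formalization: In (e), confinement b' (in *A with |A|<b') is proved for uncountable b'<b; at b'=ℵ₀ it fails (finite A give *A=A, so X=ℕ has only countably many such elements), so for all infinite b'<b the form |A|≤b' is proved. Classes are subsets of a type, sets those of size <κ, any κ>b. *)

theory Defs
  imports Main "HOL-Library.FuncSet"
begin

unbundle cardinal_syntax

text \<open>
  Conventions. \<open>B^E\<close> is \<open>E \<rightarrow>\<^sub>E B\<close>. A cardinal is a relation \<open>m\<close> with \<open>Card_order m\<close>;
  \<open>m\<^sup>+\<close> is \<open>cardSuc m\<close>, and \<open>2^b\<close> is \<open>|Pow B|\<close> for \<open>b = |B|\<close>. Tuples are lists.
\<close>

section \<open>Lim-rims\<close>

definition cylinders :: "'b set \<Rightarrow> 'e set \<Rightarrow> ('e \<Rightarrow> 'b) set set" where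
  "cylinders B E = {{\<psi> \<in> E \<rightarrow>\<^sub>E B. restrict \<psi> J \<in> R} | J R.
      J \<subseteq> E \<and> finite J \<and> R \<subseteq> (J \<rightarrow>\<^sub>E B)}"

definition cyl_ultrafilter :: "'b set \<Rightarrow> 'e set \<Rightarrow> ('e \<Rightarrow> 'b) set set \<Rightarrow> bool" where
  "cyl_ultrafilter B E U \<longleftrightarrow>
     U \<subseteq> cylinders B E \<and>
     (E \<rightarrow>\<^sub>E B) \<in> U \<and> {} \<notin> U \<and>
     (\<forall>C\<in>U. \<forall>D\<in>U. C \<inter> D \<in> U) \<and>
     (\<forall>C\<in>U. \<forall>D\<in>cylinders B E. C \<subseteq> D \<longrightarrow> D \<in> U) \<and>
     (\<forall>C\<in>cylinders B E. C \<in> U \<or> (E \<rightarrow>\<^sub>E B) - C \<in> U)"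

definition lim_rim :: "'b set \<Rightarrow> 'e set \<Rightarrow> ('e \<Rightarrow> 'b) set set \<Rightarrow> bool" where
  "lim_rim B E L \<longleftrightarrow> cyl_ultrafilter B E L"

text \<open>\<open>lr_rel B E L n R\<close> is \<open>R^E \<subseteq> E^n\<close>, for \<open>R \<subseteq> B^n\<close>.\<close>

definition lr_rel ::
  "'b set \<Rightarrow> 'e set \<Rightarrow> ('e \<Rightarrow> 'b) set set \<Rightarrow> nat \<Rightarrow> 'b list set \<Rightarrow> 'e list set" where
  "lr_rel B E L n R = {es. length es = n \<and> set es \<subseteq> E \<and> {\<psi> \<in> E \<rightarrow>\<^sub>E B. map \<psi> es \<in> R} \<in> L}"

definition separated :: "'b set \<Rightarrow> 'e set \<Rightarrow> ('e \<Rightarrow> 'b) set set \<Rightarrow> bool" where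
  "separated B E L \<longleftrightarrow>
     (\<forall>e\<in>E. \<forall>e'\<in>E. {\<psi> \<in> E \<rightarrow>\<^sub>E B. \<psi> e = \<psi> e'} \<in> L \<longrightarrow> e = e')"

text \<open>\<open>pull B E L I \<eta>\<close> is \<open>L\<^sub>\<eta>\<close>, for \<open>\<eta> : I \<rightarrow> E\<close>.\<close>

definition pull ::
  "'b set \<Rightarrow> 'e set \<Rightarrow> ('e \<Rightarrow> 'b) set set \<Rightarrow> 'i set \<Rightarrow> ('i \<Rightarrow> 'e) \<Rightarrow> ('i \<Rightarrow> 'b) set set" where
  "pull B E L I \<eta> = {C \<in> cylinders B I. {\<psi> \<in> E \<rightarrow>\<^sub>E B. compose I \<psi> \<eta> \<in> C} \<in> L}"

definition projection ::
  "'b set \<Rightarrow> 'i set \<Rightarrow> ('i \<Rightarrow> 'b) set set \<Rightarrow> 'i set \<Rightarrow> ('i \<Rightarrow> 'b) set set" where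
  "projection B I' U I = {C \<in> cylinders B I. {\<phi> \<in> I' \<rightarrow>\<^sub>E B. restrict \<phi> I \<in> C} \<in> U}"

text \<open>
  The index sets \<open>I \<union> {i}\<close> are taken in the type underlying the cardinal \<open>m\<close>. This is no
  restriction: \<open>|I| < m\<close> implies \<open>|I \<union> {i}| \<le> m\<close>, so every such index set has a copy there,
  and the condition only depends on \<open>I\<close> and \<open>i\<close> up to bijection.
\<close>

definition exact_for ::
  "'m rel \<Rightarrow> 'b set \<Rightarrow> 'e set \<Rightarrow> ('e \<Rightarrow> 'b) set set \<Rightarrow> bool" where
  "exact_for m B E L \<longleftrightarrow>
     (\<forall>(I :: 'm set) i \<eta> U.
        |I| <o m \<longrightarrow> i \<notin> I \<longrightarrow> \<eta> \<in> I \<rightarrow> E \<longrightarrow>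
        cyl_ultrafilter B (insert i I) U \<longrightarrow>
        projection B (insert i I) U I = pull B E L I \<eta> \<longrightarrow>
        (\<exists>\<eta>' \<in> insert i I \<rightarrow> E. (\<forall>j\<in>I. \<eta>' j = \<eta> j) \<and> pull B E L (insert i I) \<eta>' = U))"

definition exact_lim_rim :: "'b set \<Rightarrow> 'e set \<Rightarrow> ('e \<Rightarrow> 'b) set set \<Rightarrow> bool" where
  "exact_lim_rim B E L \<longleftrightarrow> lim_rim B E L \<and> separated B E L \<and> exact_for natLeq B E L"

definition saturated_for ::
  "'m rel \<Rightarrow> 'b set \<Rightarrow> 'e set \<Rightarrow> ('e \<Rightarrow> 'b) set set \<Rightarrow> bool" where
  "saturated_for m B E L \<longleftrightarrow>
     (\<forall>n. \<forall>F \<subseteq> {{x. length x = n \<and> set x \<subseteq> E \<and> x @ [e] \<in> lr_rel B E L (Suc n) R} | R e.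
                   R \<subseteq> {bs. length bs = Suc n \<and> set bs \<subseteq> B} \<and> e \<in> E}.
        |F| <o m \<longrightarrow>
        (\<forall>G \<subseteq> F. finite G \<longrightarrow> {x. length x = n \<and> set x \<subseteq> E} \<inter> \<Inter>G \<noteq> {}) \<longrightarrow>
        {x. length x = n \<and> set x \<subseteq> E} \<inter> \<Inter>F \<noteq> {})"

definition regular_lim_rim :: "'b set \<Rightarrow> 'e set \<Rightarrow> ('e \<Rightarrow> 'b) set set \<Rightarrow> bool" where
  "regular_lim_rim B E L \<longleftrightarrow>
     lim_rim B E L \<and> separated B E L \<and> |E| =o |Pow (Pow B)| \<and>
     exact_for (cardSuc |Pow B| ) B E L"

section \<open>Cylindrical ultrapowers\<close>

text \<open>
  Sets and classes. HOL has no proper classes, so the distinction is expressed relative to a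
  cardinal \<open>\<kappa> > |B|\<close>: a class is an arbitrary subset \<open>X\<close> of a type, and it is a set if
  \<open>|X| < \<kappa>\<close>. With \<open>\<kappa>\<close> large every given \<open>X\<close> is a set; with \<open>\<kappa>\<close> the size of a
  Grothendieck universe one gets the usual sets and classes.
\<close>

definition is_set :: "'k rel \<Rightarrow> 'a set \<Rightarrow> bool" where
  "is_set \<kappa> X \<longleftrightarrow> |X| <o \<kappa>"

text \<open>Maps \<open>B^E \<rightarrow> A\<close> depending on finitely many coordinates only.\<close>

definition cyl_maps :: "'b set \<Rightarrow> 'e set \<Rightarrow> 'a set \<Rightarrow> (('e \<Rightarrow> 'b) \<Rightarrow> 'a) set" where
  "cyl_maps B E A = {f \<in> (E \<rightarrow>\<^sub>E B) \<rightarrow>\<^sub>E A. \<exists>J. J \<subseteq> E \<and> finite J \<and>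
      (\<forall>\<psi> \<in> E \<rightarrow>\<^sub>E B. \<forall>\<psi>' \<in> E \<rightarrow>\<^sub>E B. (\<forall>j\<in>J. \<psi> j = \<psi>' j) \<longrightarrow> f \<psi> = f \<psi>')}"

text \<open>
  The class of \<open>f\<close> is formed among all maps into the ambient type, not only those into a given
  \<open>A\<close>. This makes the embeddings of \<open>*A\<close> into \<open>*X\<close> for \<open>A \<subseteq> X\<close> inclusions, and the direct
  limit over the sets \<open>A \<subseteq> X\<close> a union.
\<close>

definition ucls ::
  "'b set \<Rightarrow> 'e set \<Rightarrow> ('e \<Rightarrow> 'b) set set \<Rightarrow> (('e \<Rightarrow> 'b) \<Rightarrow> 'a) \<Rightarrow> (('e \<Rightarrow> 'b) \<Rightarrow> 'a) set" where
  "ucls B E L f = {g \<in> cyl_maps B E UNIV. {\<psi> \<in> E \<rightarrow>\<^sub>E B. f \<psi> = g \<psi>} \<in> L}"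

definition star_maps :: "'k rel \<Rightarrow> 'b set \<Rightarrow> 'e set \<Rightarrow> 'a set \<Rightarrow> (('e \<Rightarrow> 'b) \<Rightarrow> 'a) set" where
  "star_maps \<kappa> B E X = \<Union> {cyl_maps B E A | A. A \<subseteq> X \<and> is_set \<kappa> A}"

definition star ::
  "'k rel \<Rightarrow> 'b set \<Rightarrow> 'e set \<Rightarrow> ('e \<Rightarrow> 'b) set set \<Rightarrow> 'a set \<Rightarrow> (('e \<Rightarrow> 'b) \<Rightarrow> 'a) set set" where
  "star \<kappa> B E L X = ucls B E L ` star_maps \<kappa> B E X"

lemma star_maps_set:
  assumes "is_set \<kappa> X"
  shows "star_maps \<kappa> B E X = cyl_maps B E X"
proof -
  have "cyl_maps B E A \<subseteq> cyl_maps B E X" if "A \<subseteq> X" for A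
    using that PiE_mono[of "E \<rightarrow>\<^sub>E B" "\<lambda>_. A" "\<lambda>_. X"] unfolding cyl_maps_def by blast
  then show ?thesis
    using assms unfolding star_maps_def by blast
qed

lemma star_set: "is_set \<kappa> X \<Longrightarrow> star \<kappa> B E L X = ucls B E L ` cyl_maps B E X"
  by (simp add: star_def star_maps_set)

lemma star_direct_limit: "star \<kappa> B E L X = (\<Union>A \<in> {A. A \<subseteq> X \<and> is_set \<kappa> A}. star \<kappa> B E L A)"
proof -
  have "star \<kappa> B E L X = (\<Union>A \<in> {A. A \<subseteq> X \<and> is_set \<kappa> A}. ucls B E L ` cyl_maps B E A)"
    by (simp only: star_def star_maps_def setcompr_eq_image image_UN)
  also have "\<dots> = (\<Union>A \<in> {A. A \<subseteq> X \<and> is_set \<kappa> A}. star \<kappa> B E L A)"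
    by (rule SUP_cong) (simp_all only: star_set mem_Collect_eq)
  finally show ?thesis .
qed

text \<open>\<open>star_rel\<close> is \<open>*R\<close> for \<open>R \<subseteq> X\<^sub>1 \<times> \<dots> \<times> X\<^sub>k\<close>, where \<open>Xs = [X\<^sub>1, \<dots>, X\<^sub>k]\<close>.\<close>

definition star_rel ::
  "'k rel \<Rightarrow> 'b set \<Rightarrow> 'e set \<Rightarrow> ('e \<Rightarrow> 'b) set set \<Rightarrow> 'a set list \<Rightarrow> 'a list set
    \<Rightarrow> (('e \<Rightarrow> 'b) \<Rightarrow> 'a) set list set" where
  "star_rel \<kappa> B E L Xs R = {map (ucls B E L) fs | fs.
      list_all2 (\<lambda>f X. f \<in> star_maps \<kappa> B E X) fs Xs \<and>
      {\<psi> \<in> E \<rightarrow>\<^sub>E B. map (\<lambda>f. f \<psi>) fs \<in> R} \<in> L}"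

text \<open>The same for \<open>R \<subseteq> X \<times> Y\<close>, with \<open>X\<close> and \<open>Y\<close> in different types.\<close>

definition star_rel2 ::
  "'k rel \<Rightarrow> 'b set \<Rightarrow> 'e set \<Rightarrow> ('e \<Rightarrow> 'b) set set \<Rightarrow> 'a set \<Rightarrow> 'y set \<Rightarrow> ('a \<times> 'y) set
    \<Rightarrow> ((('e \<Rightarrow> 'b) \<Rightarrow> 'a) set \<times> (('e \<Rightarrow> 'b) \<Rightarrow> 'y) set) set" where
  "star_rel2 \<kappa> B E L X Y R = {(ucls B E L f, ucls B E L g) | f g.
      f \<in> star_maps \<kappa> B E X \<and> g \<in> star_maps \<kappa> B E Y \<and>
      {\<psi> \<in> E \<rightarrow>\<^sub>E B. (f \<psi>, g \<psi>) \<in> R} \<in> L}"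

text \<open>
  The type of the parameter sets \<open>Y\<close> is an argument, since it cannot be quantified inside a
  formula. A family of internal sets may use different \<open>Y\<close>, all inside this type.
\<close>

definition internal ::
  "'k rel \<Rightarrow> 'b set \<Rightarrow> 'e set \<Rightarrow> ('e \<Rightarrow> 'b) set set \<Rightarrow> 'y itself \<Rightarrow> 'a set
    \<Rightarrow> (('e \<Rightarrow> 'b) \<Rightarrow> 'a) set set \<Rightarrow> bool" where
  "internal \<kappa> B E L _ X S \<longleftrightarrow>
     (\<exists>(Y :: 'y set) R. \<exists>y \<in> star \<kappa> B E L Y.
        is_set \<kappa> Y \<and> is_set \<kappa> R \<and> R \<subseteq> X \<times> Y \<and>
        S = {x \<in> star \<kappa> B E L X. (x, y) \<in> star_rel2 \<kappa> B E L X Y R})"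

definition internal_intersection ::
  "'m rel \<Rightarrow> 'k rel \<Rightarrow> 'b set \<Rightarrow> 'e set \<Rightarrow> ('e \<Rightarrow> 'b) set set \<Rightarrow> 'y itself \<Rightarrow> 'a set \<Rightarrow> bool" where
  "internal_intersection m \<kappa> B E L T X \<longleftrightarrow>
     (\<forall>F \<subseteq> {S. internal \<kappa> B E L T X S}.
        |F| <o m \<longrightarrow>
        (\<forall>G \<subseteq> F. finite G \<longrightarrow> star \<kappa> B E L X \<inter> \<Inter>G \<noteq> {}) \<longrightarrow>
        star \<kappa> B E L X \<inter> \<Inter>F \<noteq> {})"

definition confined ::
  "'m rel \<Rightarrow> 'k rel \<Rightarrow> 'b set \<Rightarrow> 'e set \<Rightarrow> ('e \<Rightarrow> 'b) set set
    \<Rightarrow> (('e \<Rightarrow> 'b) \<Rightarrow> 'a) set \<Rightarrow> bool" where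
  "confined m \<kappa> B E L x \<longleftrightarrow> (\<exists>A. is_set \<kappa> A \<and> |A| <o m \<and> x \<in> star \<kappa> B E L A)"

section \<open>Many-sorted first-order logic with equality\<close>

text \<open>A variable is a pair of its sort and a number.\<close>

datatype ('s, 'r) fm =
    Eq "'s \<times> nat" "'s \<times> nat"
  | Rel 'r "('s \<times> nat) list"
  | Neg "('s, 'r) fm"
  | Conj "('s, 'r) fm" "('s, 'r) fm"
  | Exi "'s \<times> nat" "('s, 'r) fm"

primrec well_sorted :: "('r \<Rightarrow> 's list) \<Rightarrow> ('s, 'r) fm \<Rightarrow> bool" where
  "well_sorted ar (Eq u v) \<longleftrightarrow> fst u = fst v"
| "well_sorted ar (Rel r vs) \<longleftrightarrow> map fst vs = ar r"
| "well_sorted ar (Neg p) \<longleftrightarrow> well_sorted ar p"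
| "well_sorted ar (Conj p q) \<longleftrightarrow> well_sorted ar p \<and> well_sorted ar q"
| "well_sorted ar (Exi v p) \<longleftrightarrow> well_sorted ar p"

primrec free_vars :: "('s, 'r) fm \<Rightarrow> ('s \<times> nat) set" where
  "free_vars (Eq u v) = {u, v}"
| "free_vars (Rel r vs) = set vs"
| "free_vars (Neg p) = free_vars p"
| "free_vars (Conj p q) = free_vars p \<union> free_vars q"
| "free_vars (Exi v p) = free_vars p - {v}"

definition sentence :: "('r \<Rightarrow> 's list) \<Rightarrow> ('s, 'r) fm \<Rightarrow> bool" where
  "sentence ar p \<longleftrightarrow> well_sorted ar p \<and> free_vars p = {}"

primrec sat ::
  "('s \<Rightarrow> 'x set) \<Rightarrow> ('r \<Rightarrow> 'x list set) \<Rightarrow> ('s \<times> nat \<Rightarrow> 'x) \<Rightarrow> ('s, 'r) fm \<Rightarrow> bool" where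
  "sat X P a (Eq u v) \<longleftrightarrow> a u = a v"
| "sat X P a (Rel r vs) \<longleftrightarrow> map a vs \<in> P r"
| "sat X P a (Neg p) \<longleftrightarrow> \<not> sat X P a p"
| "sat X P a (Conj p q) \<longleftrightarrow> sat X P a p \<and> sat X P a q"
| "sat X P a (Exi v p) \<longleftrightarrow> (\<exists>x \<in> X (fst v). sat X P (a(v := x)) p)"

text \<open>
  Sorts may be empty, so the assignment ranges over the whole type; for sentences its choice is
  irrelevant.
\<close>

definition true_in :: "('s \<Rightarrow> 'x set) \<Rightarrow> ('r \<Rightarrow> 'x list set) \<Rightarrow> ('s, 'r) fm \<Rightarrow> bool" where
  "true_in X P p \<longleftrightarrow> (\<forall>a. sat X P a p)"

lemma sat_cong_free_vars:
  "(\<And>v. v \<in> free_vars p \<Longrightarrow> a v = a' v) \<Longrightarrow> sat X P a p = sat X P a' p"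
proof (induction p arbitrary: a a')
  case (Eq u v)
  then show ?case by simp
next
  case (Neg p)
  have "sat X P a p = sat X P a' p" by (rule Neg.IH) (use Neg.prems in simp)
  then show ?case by (simp only: sat.simps)
next
  case (Rel r vs)
  then have "map a vs = map a' vs" by simp
  then show ?case by (simp only: sat.simps)
next
  case (Conj p q)
  have "sat X P a p = sat X P a' p" by (rule Conj.IH) (use Conj.prems in simp)
  moreover have "sat X P a q = sat X P a' q" by (rule Conj.IH) (use Conj.prems in simp)
  ultimately show ?case by (simp only: sat.simps)
next
  case (Exi v p)
  have "sat X P (a(v := x)) p = sat X P (a'(v := x)) p" for x
    by (rule Exi.IH) (use Exi.prems in auto)
  then show ?case by (simp only: sat.simps)
qed

lemma true_in_iff_sat: "sentence ar p \<Longrightarrow> true_in X P p \<longleftrightarrow> sat X P a p"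
proof -
  assume "sentence ar p"
  then have "sat X P a' p = sat X P a p" for a'
    by (intro sat_cong_free_vars) (simp add: sentence_def)
  then show ?thesis
    unfolding true_in_def by iprover
qed

end

theory Submission
  imports Defs "HOL-Library.Nat_Bijection"
begin

text \<open>
  Everything rests on maps \<open>f\<close> on \<open>B\<^sup>E\<close> that depend on finitely many coordinates: \<open>P\<close> is such a
  predicate exactly if \<open>{\<psi>. P \<psi>}\<close> is a cylinder, so the ultrafilter decides it, and
  \<open>\<psi> \<mapsto> h (f \<psi>)\<close> is again such a map for every \<open>h\<close>, however wild.

  Transfer is the theorem of Los. In the existential step a witness can be chosen as a function
  of the values of the finitely many parameters, so it again depends on finitely many
  coordinates. As \<open>B\<close> is infinite, such a map has at most \<open>|B|\<close> values
  (\<open>fin_dep_card_image\<close>): this is the confinement statement, and it also shows that the witness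
  takes its values in a set.

  Exactness for finite index sets says that every such map \<open>f : B\<^sup>E \<rightarrow> B\<close> agrees almost everywhere
  with a single coordinate (\<open>coordinate_representation\<close>), that is, \<open>*B\<close> is \<open>E\<close>. Hence each
  element of \<open>*X\<close> is \<open>[g(\<psi>\<^sub>e)]\<close> with \<open>e \<in> E\<close> and \<open>g : B \<rightarrow> X\<close> (\<open>star_single_coordinate\<close>), and an
  internal set of classes \<open>[f]\<close> is given by a condition \<open>(f(\<psi>), \<psi>\<^sub>e) \<in> Q\<close> for one \<open>e \<in> E\<close>
  (\<open>internal_binary\<close>).

  For a family of at most \<open>|B|\<close> internal sets with the finite intersection property, pick a
  point in each finite intersection; by confinement all these points lie in \<open>*X'\<close> for one
  \<open>X' \<subseteq> X\<close> with \<open>|X'| \<le> |B|\<close>. A surjection \<open>B \<rightarrow> X'\<close> turns the problem into finding \<open>x \<in> E\<close> with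
  \<open>(\<psi>\<^sub>x, \<psi>\<^sub>e) \<in> R\<close> almost everywhere, for all members \<open>(R, e)\<close> of a family of pairs that is finitely
  solvable (\<open>binary_saturated\<close>). That is saturation of \<open>E\<close>. In a regular lim-rim it holds for
  families of size up to \<open>2\<^sup>b\<close>: the conditions together with the type of the parameters generate
  an ultrafilter of cylinders with one more index, and exactness realizes it.

  The upper bound for \<open>|*X|\<close> counts the pairs \<open>(e, g)\<close>. For the lower bound it suffices to find
  \<open>2\<close> to the power \<open>2\<^sup>b\<close> many elements of \<open>*N\<close> for a countably infinite \<open>N \<subseteq> X\<close>; these are
  confined by every uncountable cardinal. By saturation \<open>|*N| > 2\<^sup>b\<close>, so choose \<open>2\<^sup>b\<close> distinct
  elements; again by saturation, each set of them is cut out by the binary digits of some element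
  of \<open>*N\<close> (\<open>card_star_countable_ge\<close>).
\<close>

section \<open>Dependence on finitely many coordinates\<close>

definition fin_dep :: "'b set \<Rightarrow> 'e set \<Rightarrow> (('e \<Rightarrow> 'b) \<Rightarrow> 'a) \<Rightarrow> bool" where
  "fin_dep B E f \<longleftrightarrow> (\<exists>J. J \<subseteq> E \<and> finite J \<and>
      (\<forall>\<psi> \<in> E \<rightarrow>\<^sub>E B. \<forall>\<psi>' \<in> E \<rightarrow>\<^sub>E B. (\<forall>j\<in>J. \<psi> j = \<psi>' j) \<longrightarrow> f \<psi> = f \<psi>'))"

lemma restrict_eqD: "restrict f J = restrict g J \<Longrightarrow> j \<in> J \<Longrightarrow> f j = g j"
  by (metis restrict_apply')

lemma fin_depI:
  assumes "J \<subseteq> E" "finite J"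
    and "\<And>\<psi> \<psi>'. \<psi> \<in> E \<rightarrow>\<^sub>E B \<Longrightarrow> \<psi>' \<in> E \<rightarrow>\<^sub>E B \<Longrightarrow> (\<And>j. j \<in> J \<Longrightarrow> \<psi> j = \<psi>' j) \<Longrightarrow> f \<psi> = f \<psi>'"
  shows "fin_dep B E f"
  unfolding fin_dep_def by (intro exI[of _ J] conjI ballI impI assms) simp_all

lemma cyl_maps_iff: "f \<in> cyl_maps B E A \<longleftrightarrow> f \<in> (E \<rightarrow>\<^sub>E B) \<rightarrow>\<^sub>E A \<and> fin_dep B E f"
  unfolding cyl_maps_def fin_dep_def by simp

lemma fin_depE:
  assumes "fin_dep B E f"
  obtains J where "J \<subseteq> E" "finite J"
    "\<And>\<psi> \<psi>'. \<psi> \<in> E \<rightarrow>\<^sub>E B \<Longrightarrow> \<psi>' \<in> E \<rightarrow>\<^sub>E B \<Longrightarrow> (\<And>j. j \<in> J \<Longrightarrow> \<psi> j = \<psi>' j) \<Longrightarrow> f \<psi> = f \<psi>'"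
proof -
  obtain J where J: "J \<subseteq> E" "finite J"
    and eq: "\<forall>\<psi> \<in> E \<rightarrow>\<^sub>E B. \<forall>\<psi>' \<in> E \<rightarrow>\<^sub>E B. (\<forall>j\<in>J. \<psi> j = \<psi>' j) \<longrightarrow> f \<psi> = f \<psi>'"
    using assms unfolding fin_dep_def by (elim exE conjE)
  show thesis
    by (rule that[OF J], rule eq[rule_format])
qed

lemma fin_dep_const [simp]: "fin_dep B E (\<lambda>_. c)"
  by (rule fin_depI[of "{}"]) auto

lemma fin_dep_coord [simp]: "e \<in> E \<Longrightarrow> fin_dep B E (\<lambda>\<psi>. \<psi> e)"
  by (rule fin_depI[of "{e}"]) auto

lemma fin_dep_comp: "fin_dep B E f \<Longrightarrow> fin_dep B E (\<lambda>\<psi>. h (f \<psi>))"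
  unfolding fin_dep_def by metis

lemma fin_dep_comp2:
  assumes "fin_dep B E f" "fin_dep B E g"
  shows "fin_dep B E (\<lambda>\<psi>. h (f \<psi>) (g \<psi>))"
proof -
  obtain J where J: "J \<subseteq> E" "finite J"
    "\<And>\<psi> \<psi>'. \<psi> \<in> E \<rightarrow>\<^sub>E B \<Longrightarrow> \<psi>' \<in> E \<rightarrow>\<^sub>E B \<Longrightarrow> (\<And>j. j \<in> J \<Longrightarrow> \<psi> j = \<psi>' j) \<Longrightarrow> f \<psi> = f \<psi>'"
    by (fact fin_depE[OF assms(1)])
  obtain K where K: "K \<subseteq> E" "finite K"
    "\<And>\<psi> \<psi>'. \<psi> \<in> E \<rightarrow>\<^sub>E B \<Longrightarrow> \<psi>' \<in> E \<rightarrow>\<^sub>E B \<Longrightarrow> (\<And>j. j \<in> K \<Longrightarrow> \<psi> j = \<psi>' j) \<Longrightarrow> g \<psi> = g \<psi>'"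
    by (fact fin_depE[OF assms(2)])
  show ?thesis
  proof (rule fin_depI[of "J \<union> K"])
    fix \<psi> \<psi>' assume *: "\<psi> \<in> E \<rightarrow>\<^sub>E B" "\<psi>' \<in> E \<rightarrow>\<^sub>E B" "\<And>j. j \<in> J \<union> K \<Longrightarrow> \<psi> j = \<psi>' j"
    have "f \<psi> = f \<psi>'" by (rule J(3)[OF *(1,2)], rule *(3)) simp
    moreover have "g \<psi> = g \<psi>'" by (rule K(3)[OF *(1,2)], rule *(3)) simp
    ultimately show "h (f \<psi>) (g \<psi>) = h (f \<psi>') (g \<psi>')" by simp
  qed (use J K in auto)
qed

lemma fin_dep_cong:
  assumes "\<And>\<psi>. \<psi> \<in> E \<rightarrow>\<^sub>E B \<Longrightarrow> f \<psi> = g \<psi>"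
  shows "fin_dep B E f \<longleftrightarrow> fin_dep B E g"
  unfolding fin_dep_def by (simp add: assms cong: ball_cong)

text \<open>
  Tupling a finite family, so that \<open>fin_dep_comp\<close> yields closure under functions of finitely many
  arguments.
\<close>

lemma fin_dep_family:
  assumes "finite K" "\<And>k. k \<in> K \<Longrightarrow> fin_dep B E (f k)"
  shows "fin_dep B E (\<lambda>\<psi>. restrict (\<lambda>k. f k \<psi>) K)"
  using assms
proof (induction K)
  case empty
  then show ?case by simp
next
  case (insert k K)
  have "fin_dep B E (\<lambda>\<psi>. (restrict (\<lambda>k. f k \<psi>) K)(k := f k \<psi>))"
    by (rule fin_dep_comp2[where h = "\<lambda>r x. r(k := x)", OF insert.IH insert.prems])
      (simp_all add: insert.prems)
  moreover have "(restrict (\<lambda>k. f k \<psi>) K)(k := f k \<psi>) = restrict (\<lambda>k. f k \<psi>) (insert k K)" for \<psi>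
    by (auto simp: restrict_def)
  ultimately show ?case by (simp only:)
qed

lemma cylinders_iff: "C \<in> cylinders B E \<longleftrightarrow> C \<subseteq> E \<rightarrow>\<^sub>E B \<and> fin_dep B E (\<lambda>\<psi>. \<psi> \<in> C)"
proof
  assume "C \<in> cylinders B E"
  then obtain J R where J: "J \<subseteq> E" "finite J" "C = {\<psi> \<in> E \<rightarrow>\<^sub>E B. restrict \<psi> J \<in> R}"
    unfolding cylinders_def by blast
  have "fin_dep B E (\<lambda>\<psi>. \<psi> \<in> C)"
  proof (rule fin_depI[OF J(1,2)])
    fix \<psi> \<psi>' assume "\<psi> \<in> E \<rightarrow>\<^sub>E B" "\<psi>' \<in> E \<rightarrow>\<^sub>E B" "\<And>j. j \<in> J \<Longrightarrow> \<psi> j = \<psi>' j"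
    then have "restrict \<psi> J = restrict \<psi>' J" by (auto simp: restrict_def)
    then show "(\<psi> \<in> C) = (\<psi>' \<in> C)" using J(3) \<open>\<psi> \<in> _\<close> \<open>\<psi>' \<in> _\<close> by simp
  qed
  then show "C \<subseteq> E \<rightarrow>\<^sub>E B \<and> fin_dep B E (\<lambda>\<psi>. \<psi> \<in> C)" using J(3) by blast
next
  assume C: "C \<subseteq> E \<rightarrow>\<^sub>E B \<and> fin_dep B E (\<lambda>\<psi>. \<psi> \<in> C)"
  obtain J where J: "J \<subseteq> E" "finite J" "\<And>\<psi> \<psi>'. \<psi> \<in> E \<rightarrow>\<^sub>E B \<Longrightarrow> \<psi>' \<in> E \<rightarrow>\<^sub>E B \<Longrightarrow>
      (\<And>j. j \<in> J \<Longrightarrow> \<psi> j = \<psi>' j) \<Longrightarrow> (\<psi> \<in> C) = (\<psi>' \<in> C)"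
    by (fact fin_depE[OF conjunct2[OF C]])
  let ?R = "(\<lambda>\<psi>. restrict \<psi> J) ` C"
  have "C = {\<psi> \<in> E \<rightarrow>\<^sub>E B. restrict \<psi> J \<in> ?R}"
  proof (intro equalityI subsetI CollectI conjI)
    fix \<psi> assume "\<psi> \<in> {\<psi> \<in> E \<rightarrow>\<^sub>E B. restrict \<psi> J \<in> ?R}"
    then obtain \<psi>' where *: "\<psi> \<in> E \<rightarrow>\<^sub>E B" "\<psi>' \<in> C" "restrict \<psi> J = restrict \<psi>' J" by auto
    have "(\<psi> \<in> C) = (\<psi>' \<in> C)"
      by (rule J(3)) (use * C in \<open>auto dest: restrict_eqD\<close>)
    then show "\<psi> \<in> C" using *(2) by simp
  qed (use C in auto)
  moreover have "?R \<subseteq> J \<rightarrow>\<^sub>E B" using C J(1) by (auto simp: PiE_def Pi_def subset_iff)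
  ultimately show "C \<in> cylinders B E" unfolding cylinders_def using J(1,2) by blast
qed

lemma Collect_cylinders_iff: "{\<psi> \<in> E \<rightarrow>\<^sub>E B. P \<psi>} \<in> cylinders B E \<longleftrightarrow> fin_dep B E P"
  unfolding cylinders_iff using fin_dep_cong[of E B "\<lambda>\<psi>. \<psi> \<in> {\<psi> \<in> E \<rightarrow>\<^sub>E B. P \<psi>}" P] by simp

lemma finite_PiE_card:
  fixes B :: "'b set" and J :: "'e set"
  assumes "infinite B" "finite J"
  shows "|J \<rightarrow>\<^sub>E B| \<le>o |B|"
  using assms(2)
proof (induction J)
  case empty
  have "|{\<lambda>x::'e. undefined::'b}| \<le>o |B|"
    using assms(1) by (intro card_of_singl_ordLeq) auto
  then show ?case by simp
next
  case (insert j J)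
  have "|B \<times> (J \<rightarrow>\<^sub>E B)| \<le>o |B|"
    by (rule card_of_Times_ordLeq_infinite_Field[OF _ ordLeq_refl[OF card_of_Card_order]
          insert.IH card_of_Card_order]) (simp add: assms(1) Field_card_of)
  then show ?case
    unfolding PiE_insert_eq by (rule ordLeq_transitive[OF card_of_image])
qed

text \<open>
  Only the restriction of \<open>\<psi>\<close> to a finite set \<open>J\<close> matters, and \<open>|B\<^sup>J| \<le> |B|\<close>.
\<close>

lemma fin_dep_card_image:
  assumes "infinite B" "fin_dep B E f"
  shows "|f ` (E \<rightarrow>\<^sub>E B)| \<le>o |B|"
proof -
  obtain J where J: "J \<subseteq> E" "finite J" "\<And>\<psi> \<psi>'. \<psi> \<in> E \<rightarrow>\<^sub>E B \<Longrightarrow> \<psi>' \<in> E \<rightarrow>\<^sub>E B \<Longrightarrow>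
      (\<And>j. j \<in> J \<Longrightarrow> \<psi> j = \<psi>' j) \<Longrightarrow> f \<psi> = f \<psi>'"
    by (fact fin_depE[OF assms(2)])
  let ?h = "\<lambda>r. f (SOME \<psi>. \<psi> \<in> E \<rightarrow>\<^sub>E B \<and> restrict \<psi> J = r)"
  have "f \<psi> = ?h (restrict \<psi> J)" if \<psi>: "\<psi> \<in> E \<rightarrow>\<^sub>E B" for \<psi>
  proof -
    let ?\<psi> = "SOME \<psi>'. \<psi>' \<in> E \<rightarrow>\<^sub>E B \<and> restrict \<psi>' J = restrict \<psi> J"
    have "?\<psi> \<in> E \<rightarrow>\<^sub>E B \<and> restrict ?\<psi> J = restrict \<psi> J"
      by (rule someI[of _ \<psi>]) (use \<psi> in simp)
    then show ?thesis by (intro J(3)[OF \<psi>]) (auto dest: restrict_eqD[OF sym])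
  qed
  moreover have "restrict \<psi> J \<in> J \<rightarrow>\<^sub>E B" if "\<psi> \<in> E \<rightarrow>\<^sub>E B" for \<psi>
    using that J(1) by (auto simp: PiE_def Pi_def subset_iff)
  ultimately have "f ` (E \<rightarrow>\<^sub>E B) \<subseteq> ?h ` (J \<rightarrow>\<^sub>E B)" by blast
  then show ?thesis
    by (rule ordLeq_transitive[OF surj_imp_ordLeq finite_PiE_card[OF assms(1) J(2)]])
qed

section \<open>Ultrafilters of cylinders\<close>

lemma cyl_ultrafilterD:
  assumes "cyl_ultrafilter B E U"
  shows "C \<in> U \<Longrightarrow> C \<in> cylinders B E"
    and "(E \<rightarrow>\<^sub>E B) \<in> U"
    and "{} \<notin> U"
    and "C \<in> U \<Longrightarrow> D \<in> U \<Longrightarrow> C \<inter> D \<in> U"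
    and "C \<in> U \<Longrightarrow> D \<in> cylinders B E \<Longrightarrow> C \<subseteq> D \<Longrightarrow> D \<in> U"
    and "C \<in> cylinders B E \<Longrightarrow> C \<in> U \<or> (E \<rightarrow>\<^sub>E B) - C \<in> U"
proof -
  note U = assms[unfolded cyl_ultrafilter_def]
  show "C \<in> U \<Longrightarrow> C \<in> cylinders B E" by (rule subsetD[OF U[THEN conjunct1]])
  note U = U[THEN conjunct2]
  show "(E \<rightarrow>\<^sub>E B) \<in> U" by (rule U[THEN conjunct1])
  note U = U[THEN conjunct2]
  show "{} \<notin> U" by (rule U[THEN conjunct1])
  note U = U[THEN conjunct2]
  show "C \<in> U \<Longrightarrow> D \<in> U \<Longrightarrow> C \<inter> D \<in> U" by (rule U[THEN conjunct1, rule_format])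
  note U = U[THEN conjunct2]
  show "C \<in> U \<Longrightarrow> D \<in> cylinders B E \<Longrightarrow> C \<subseteq> D \<Longrightarrow> D \<in> U"
    by (rule U[THEN conjunct1, rule_format])
  show "C \<in> cylinders B E \<Longrightarrow> C \<in> U \<or> (E \<rightarrow>\<^sub>E B) - C \<in> U"
    by (rule U[THEN conjunct2, rule_format])
qed

lemma cylinders_top: "(E \<rightarrow>\<^sub>E B) \<in> cylinders B E"
  using Collect_cylinders_iff[of E B "\<lambda>_. True"] by simp

lemma cylinders_Int: "C \<in> cylinders B E \<Longrightarrow> D \<in> cylinders B E \<Longrightarrow> C \<inter> D \<in> cylinders B E"
  using fin_dep_comp2[of B E "\<lambda>\<psi>. \<psi> \<in> C" "\<lambda>\<psi>. \<psi> \<in> D" "(\<and>)"] unfolding cylinders_iff by auto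

lemma cylinders_Compl:
  assumes "C \<in> cylinders B E"
  shows "(E \<rightarrow>\<^sub>E B) - C \<in> cylinders B E"
proof -
  have "fin_dep B E (\<lambda>\<psi>. \<psi> \<notin> C)"
    using assms fin_dep_comp[of B E "\<lambda>\<psi>. \<psi> \<in> C" Not] unfolding cylinders_iff by simp
  then show ?thesis
    using Collect_cylinders_iff[of E B "\<lambda>\<psi>. \<psi> \<notin> C"] unfolding set_diff_eq by simp
qed

lemma cylinders_vimage:
  assumes C: "C \<in> cylinders B I"
    and T: "\<And>\<psi>. \<psi> \<in> E \<rightarrow>\<^sub>E B \<Longrightarrow> T \<psi> \<in> I \<rightarrow>\<^sub>E B" "\<And>i. i \<in> I \<Longrightarrow> fin_dep B E (\<lambda>\<psi>. T \<psi> i)"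
  shows "{\<psi> \<in> E \<rightarrow>\<^sub>E B. T \<psi> \<in> C} \<in> cylinders B E"
proof -
  obtain J where J: "J \<subseteq> I" "finite J" "\<And>\<phi> \<phi>'. \<phi> \<in> I \<rightarrow>\<^sub>E B \<Longrightarrow> \<phi>' \<in> I \<rightarrow>\<^sub>E B \<Longrightarrow>
      (\<And>j. j \<in> J \<Longrightarrow> \<phi> j = \<phi>' j) \<Longrightarrow> (\<phi> \<in> C) = (\<phi>' \<in> C)"
    by (fact fin_depE[OF conjunct2[OF C[unfolded cylinders_iff]]])
  have TJ: "fin_dep B E (\<lambda>\<psi>. restrict (T \<psi>) J)"
    using fin_dep_family[of J B E "\<lambda>j \<psi>. T \<psi> j"] J T(2) by auto
  obtain K where K: "K \<subseteq> E" "finite K" "\<And>\<psi> \<psi>'. \<psi> \<in> E \<rightarrow>\<^sub>E B \<Longrightarrow> \<psi>' \<in> E \<rightarrow>\<^sub>E B \<Longrightarrow>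
      (\<And>j. j \<in> K \<Longrightarrow> \<psi> j = \<psi>' j) \<Longrightarrow> restrict (T \<psi>) J = restrict (T \<psi>') J"
    by (fact fin_depE[OF TJ])
  have "fin_dep B E (\<lambda>\<psi>. T \<psi> \<in> C)"
  proof (rule fin_depI[OF K(1,2)])
    fix \<psi> \<psi>' assume \<psi>: "\<psi> \<in> E \<rightarrow>\<^sub>E B" "\<psi>' \<in> E \<rightarrow>\<^sub>E B" "\<And>j. j \<in> K \<Longrightarrow> \<psi> j = \<psi>' j"
    have "restrict (T \<psi>) J = restrict (T \<psi>') J" by (rule K(3)[OF \<psi>])
    then show "(T \<psi> \<in> C) = (T \<psi>' \<in> C)"
      by (intro J(3) T(1) \<psi>) (rule restrict_eqD)
  qed
  then show ?thesis by (simp add: Collect_cylinders_iff)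
qed

text \<open>
  The common form of \<open>pull\<close> and \<open>projection\<close>, and the way in which a tuple of maps on \<open>B\<^sup>E\<close>
  that is not made of coordinates gets a type.
\<close>

lemma cyl_ultrafilter_vimage:
  assumes U: "cyl_ultrafilter B E L"
    and T: "\<And>\<psi>. \<psi> \<in> E \<rightarrow>\<^sub>E B \<Longrightarrow> T \<psi> \<in> I \<rightarrow>\<^sub>E B" "\<And>i. i \<in> I \<Longrightarrow> fin_dep B E (\<lambda>\<psi>. T \<psi> i)"
  shows "cyl_ultrafilter B I {C \<in> cylinders B I. {\<psi> \<in> E \<rightarrow>\<^sub>E B. T \<psi> \<in> C} \<in> L}"
proof -
  note cyl = cylinders_vimage[OF _ T]
  let ?V = "\<lambda>C. {\<psi> \<in> E \<rightarrow>\<^sub>E B. T \<psi> \<in> C}"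
  have Vtop: "?V (I \<rightarrow>\<^sub>E B) = E \<rightarrow>\<^sub>E B" using T(1) by auto
  have Vint: "?V (C \<inter> D) = ?V C \<inter> ?V D" for C D by auto
  have Vcompl: "?V ((I \<rightarrow>\<^sub>E B) - C) = (E \<rightarrow>\<^sub>E B) - ?V C" for C using T(1) by auto
  have Vmono: "?V C \<subseteq> ?V D" if "C \<subseteq> D" for C D using that by auto
  show ?thesis
    unfolding cyl_ultrafilter_def
  proof (intro conjI ballI impI)
    show "(I \<rightarrow>\<^sub>E B) \<in> {C \<in> cylinders B I. ?V C \<in> L}"
      using cylinders_top cyl_ultrafilterD(2)[OF U] unfolding mem_Collect_eq Vtop by simp
    show "{} \<notin> {C \<in> cylinders B I. ?V C \<in> L}"
      using cyl_ultrafilterD(3)[OF U] by simp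
    show "C \<inter> D \<in> {C \<in> cylinders B I. ?V C \<in> L}"
      if "C \<in> {C \<in> cylinders B I. ?V C \<in> L}" "D \<in> {C \<in> cylinders B I. ?V C \<in> L}" for C D
      using that unfolding mem_Collect_eq Vint
      by (intro conjI cylinders_Int cyl_ultrafilterD(4)[OF U]) (erule conjunct1 conjunct2)+
    show "D \<in> {C \<in> cylinders B I. ?V C \<in> L}"
      if "C \<in> {C \<in> cylinders B I. ?V C \<in> L}" "D \<in> cylinders B I" "C \<subseteq> D" for C D
    proof -
      have "?V D \<in> L"
        by (rule cyl_ultrafilterD(5)[OF U _ cyl[OF that(2)] Vmono[OF that(3)]]) (use that(1) in simp)
      then show ?thesis using that(2) by simp
    qed
    show "C \<in> {C \<in> cylinders B I. ?V C \<in> L} \<or> (I \<rightarrow>\<^sub>E B) - C \<in> {C \<in> cylinders B I. ?V C \<in> L}"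
      if "C \<in> cylinders B I" for C
      unfolding mem_Collect_eq Vcompl
      using that cylinders_Compl[OF that] cyl_ultrafilterD(6)[OF U cyl[OF that]] by simp
  qed simp
qed

lemma cyl_ultrafilter_eqI:
  assumes "cyl_ultrafilter B E U" "cyl_ultrafilter B E V" "U \<subseteq> V"
  shows "U = V"
proof (rule equalityI[OF assms(3)], rule subsetI)
  fix C assume C: "C \<in> V"
  have "C \<in> U \<or> (E \<rightarrow>\<^sub>E B) - C \<in> U"
    using cyl_ultrafilterD(1)[OF assms(2) C] by (rule cyl_ultrafilterD(6)[OF assms(1)])
  moreover have "(E \<rightarrow>\<^sub>E B) - C \<notin> V"
    using cyl_ultrafilterD(4)[OF assms(2) C] cyl_ultrafilterD(3)[OF assms(2)] by (metis Diff_disjoint)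
  ultimately show "C \<in> U" using assms(3) by blast
qed

text \<open>
  A maximal family of cylinders with the finite intersection property is an ultrafilter: a
  cylinder that meets all finite intersections could be added, and if both a cylinder and its
  complement failed to meet one, then the intersection of these two would be empty.
\<close>

lemma cyl_ultrafilter_extend:
  assumes S: "S \<subseteq> cylinders B E"
    and fip: "\<And>G. G \<subseteq> S \<Longrightarrow> finite G \<Longrightarrow> (E \<rightarrow>\<^sub>E B) \<inter> \<Inter>G \<noteq> {}"
  obtains U where "cyl_ultrafilter B E U" "S \<subseteq> U"
proof -
  define fam where "fam = {M. S \<subseteq> M \<and> M \<subseteq> cylinders B E \<and>
    (\<forall>G. G \<subseteq> M \<longrightarrow> finite G \<longrightarrow> (E \<rightarrow>\<^sub>E B) \<inter> \<Inter>G \<noteq> {})}"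
  have "\<exists>U\<in>fam. \<forall>M\<in>fam. U \<subseteq> M \<longrightarrow> M = U"
  proof (rule subset_Zorn_nonempty)
    show "fam \<noteq> {}" using assms unfolding fam_def by blast
    fix Ch assume Ch: "Ch \<noteq> {}" "subset.chain fam Ch"
    have "(E \<rightarrow>\<^sub>E B) \<inter> \<Inter>G \<noteq> {}" if G: "G \<subseteq> \<Union>Ch" "finite G" for G
    proof -
      obtain M where "M \<in> Ch" "G \<subseteq> M"
        using finite_subset_Union_chain[OF G(2,1) Ch(1)] Ch(2) by blast
      then show ?thesis using Ch(2) G(2) unfolding fam_def subset.chain_def by blast
    qed
    moreover have "Ch \<subseteq> fam" using Ch(2) unfolding subset.chain_def by blast
    then have "S \<subseteq> M" "M \<subseteq> cylinders B E" if "M \<in> Ch" for M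
      using that unfolding fam_def by blast+
    then have "S \<subseteq> \<Union>Ch" "\<Union>Ch \<subseteq> cylinders B E" using Ch(1) by blast+
    ultimately show "\<Union>Ch \<in> fam" unfolding fam_def by simp
  qed
  then obtain U where U: "U \<in> fam" and max: "\<And>M. M \<in> fam \<Longrightarrow> U \<subseteq> M \<Longrightarrow> M = U" by blast
  have Uf: "(E \<rightarrow>\<^sub>E B) \<inter> \<Inter>G \<noteq> {}" if "G \<subseteq> U" "finite G" for G
    using U that unfolding fam_def by blast
  have add: "C \<in> U" if C: "C \<in> cylinders B E"
    and meet: "\<And>G. G \<subseteq> U \<Longrightarrow> finite G \<Longrightarrow> (E \<rightarrow>\<^sub>E B) \<inter> \<Inter>G \<inter> C \<noteq> {}" for C
  proof -
    have "insert C U \<in> fam"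
      unfolding fam_def
    proof (intro CollectI conjI allI impI)
      fix G assume G: "G \<subseteq> insert C U" "finite G"
      then have "(E \<rightarrow>\<^sub>E B) \<inter> \<Inter>(G - {C}) \<inter> C \<noteq> {}" by (intro meet) auto
      then show "(E \<rightarrow>\<^sub>E B) \<inter> \<Inter>G \<noteq> {}" by blast
    qed (use U C in \<open>auto simp: fam_def\<close>)
    then show ?thesis using max by blast
  qed
  have "cyl_ultrafilter B E U"
    unfolding cyl_ultrafilter_def
  proof (intro conjI ballI impI)
    show sub: "U \<subseteq> cylinders B E" using U unfolding fam_def by blast
    show "(E \<rightarrow>\<^sub>E B) \<in> U"
      by (rule add[OF cylinders_top]) (use Uf in \<open>simp add: Int_ac\<close>)
    show "{} \<notin> U" using Uf[of "{{}}"] by auto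
    show "C \<inter> D \<in> U" if "C \<in> U" "D \<in> U" for C D
    proof (rule add)
      show "C \<inter> D \<in> cylinders B E" using that sub by (intro cylinders_Int) auto
      show "(E \<rightarrow>\<^sub>E B) \<inter> \<Inter>G \<inter> (C \<inter> D) \<noteq> {}" if "G \<subseteq> U" "finite G" for G
        using Uf[of "insert C (insert D G)"] that \<open>C \<in> U\<close> \<open>D \<in> U\<close> by (auto simp: Int_ac)
    qed
    show "D \<in> U" if "C \<in> U" "D \<in> cylinders B E" "C \<subseteq> D" for C D
    proof (rule add)
      show "(E \<rightarrow>\<^sub>E B) \<inter> \<Inter>G \<inter> D \<noteq> {}" if "G \<subseteq> U" "finite G" for G
        using Uf[of "insert C G"] that \<open>C \<in> U\<close> \<open>C \<subseteq> D\<close> by auto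
    qed (fact that(2))
    show "C \<in> U \<or> (E \<rightarrow>\<^sub>E B) - C \<in> U" if C: "C \<in> cylinders B E" for C
    proof (rule disjCI)
      assume "(E \<rightarrow>\<^sub>E B) - C \<notin> U"
      then obtain G where G: "G \<subseteq> U" "finite G" "(E \<rightarrow>\<^sub>E B) \<inter> \<Inter>G \<inter> ((E \<rightarrow>\<^sub>E B) - C) = {}"
        using add[OF cylinders_Compl[OF C]] by blast
      show "C \<in> U"
      proof (rule add[OF C])
        fix H assume H: "H \<subseteq> U" "finite H"
        have "(E \<rightarrow>\<^sub>E B) \<inter> \<Inter>(G \<union> H) \<noteq> {}" by (rule Uf) (use G H in auto)
        then show "(E \<rightarrow>\<^sub>E B) \<inter> \<Inter>H \<inter> C \<noteq> {}" using G(3) by blast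
      qed
    qed
  qed
  then show thesis using that U unfolding fam_def by blast
qed

section \<open>Almost everywhere, and equality of classes\<close>

locale lim_rim_over =
  fixes B :: "'b set" and E :: "'e set" and L :: "('e \<Rightarrow> 'b) set set"
  assumes infinite_basis: "infinite B" and ultra: "cyl_ultrafilter B E L"
begin

definition ae :: "(('e \<Rightarrow> 'b) \<Rightarrow> bool) \<Rightarrow> bool" where
  "ae P \<longleftrightarrow> {\<psi> \<in> E \<rightarrow>\<^sub>E B. P \<psi>} \<in> L"

lemma ae_mono:
  assumes "ae P" "fin_dep B E Q" "\<And>\<psi>. \<psi> \<in> E \<rightarrow>\<^sub>E B \<Longrightarrow> P \<psi> \<Longrightarrow> Q \<psi>"
  shows "ae Q"
  unfolding ae_def
  by (rule cyl_ultrafilterD(5)[OF ultra assms(1)[unfolded ae_def]])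
    (use assms(2,3) in \<open>auto simp: Collect_cylinders_iff\<close>)

lemma ae_cong:
  assumes "\<And>\<psi>. \<psi> \<in> E \<rightarrow>\<^sub>E B \<Longrightarrow> P \<psi> = Q \<psi>"
  shows "ae P = ae Q"
proof -
  have "{\<psi> \<in> E \<rightarrow>\<^sub>E B. P \<psi>} = {\<psi> \<in> E \<rightarrow>\<^sub>E B. Q \<psi>}" using assms by auto
  then show ?thesis unfolding ae_def by simp
qed

lemma ae_conj:
  assumes "ae P" "ae Q"
  shows "ae (\<lambda>\<psi>. P \<psi> \<and> Q \<psi>)"
proof -
  have "{\<psi> \<in> E \<rightarrow>\<^sub>E B. P \<psi> \<and> Q \<psi>} = {\<psi> \<in> E \<rightarrow>\<^sub>E B. P \<psi>} \<inter> {\<psi> \<in> E \<rightarrow>\<^sub>E B. Q \<psi>}" by auto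
  then show ?thesis using assms cyl_ultrafilterD(4)[OF ultra] unfolding ae_def by simp
qed

lemma ae_ex: "ae P \<Longrightarrow> \<exists>\<psi> \<in> E \<rightarrow>\<^sub>E B. P \<psi>"
  using cyl_ultrafilterD(3)[OF ultra] unfolding ae_def
  by (metis (mono_tags, lifting) empty_Collect_eq)

lemma ae_all:
  assumes "\<And>\<psi>. \<psi> \<in> E \<rightarrow>\<^sub>E B \<Longrightarrow> P \<psi>"
  shows "ae P"
proof -
  have "{\<psi> \<in> E \<rightarrow>\<^sub>E B. P \<psi>} = E \<rightarrow>\<^sub>E B" using assms by auto
  then show ?thesis using cyl_ultrafilterD(2)[OF ultra] unfolding ae_def by simp
qed

lemma ae_not:
  assumes "fin_dep B E P"
  shows "ae (\<lambda>\<psi>. \<not> P \<psi>) \<longleftrightarrow> \<not> ae P"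
proof
  show "\<not> ae P" if "ae (\<lambda>\<psi>. \<not> P \<psi>)"
  proof
    assume "ae P"
    from ae_ex[OF ae_conj[OF this that]] show False by blast
  qed
  have "{\<psi> \<in> E \<rightarrow>\<^sub>E B. \<not> P \<psi>} = (E \<rightarrow>\<^sub>E B) - {\<psi> \<in> E \<rightarrow>\<^sub>E B. P \<psi>}" by auto
  then show "ae (\<lambda>\<psi>. \<not> P \<psi>)" if "\<not> ae P"
    using that cyl_ultrafilterD(6)[OF ultra Collect_cylinders_iff[THEN iffD2, OF assms]]
    unfolding ae_def by simp
qed

lemma ae_ball:
  assumes "finite K" "\<And>k. k \<in> K \<Longrightarrow> ae (P k)"
  shows "ae (\<lambda>\<psi>. \<forall>k\<in>K. P k \<psi>)"
  using assms
proof (induction K)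
  case empty
  then show ?case by (simp add: ae_all)
next
  case (insert k K)
  have "ae (\<lambda>\<psi>. P k \<psi> \<and> (\<forall>k\<in>K. P k \<psi>))"
    by (rule ae_conj) (use insert in auto)
  then show ?case by simp
qed

lemma ucls_eq_iff:
  assumes f: "fin_dep B E f" and g: "fin_dep B E g"
  shows "ucls B E L f = ucls B E L g \<longleftrightarrow> ae (\<lambda>\<psi>. f \<psi> = g \<psi>)"
proof
  let ?g = "restrict g (E \<rightarrow>\<^sub>E B)"
  have "fin_dep B E ?g" using g fin_dep_cong[of E B ?g g] by simp
  then have "?g \<in> ucls B E L g"
    unfolding ucls_def using ae_all[of "\<lambda>\<psi>. g \<psi> = ?g \<psi>"] by (simp add: cyl_maps_iff ae_def)
  moreover assume "ucls B E L f = ucls B E L g"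
  ultimately have "ae (\<lambda>\<psi>. f \<psi> = ?g \<psi>)" unfolding ucls_def ae_def by blast
  then show "ae (\<lambda>\<psi>. f \<psi> = g \<psi>)" using ae_cong[of "\<lambda>\<psi>. f \<psi> = ?g \<psi>"] by simp
next
  assume fg: "ae (\<lambda>\<psi>. f \<psi> = g \<psi>)"
  have "ae (\<lambda>\<psi>. f \<psi> = h \<psi>) \<longleftrightarrow> ae (\<lambda>\<psi>. g \<psi> = h \<psi>)" if "fin_dep B E h" for h
  proof
    show "ae (\<lambda>\<psi>. g \<psi> = h \<psi>)" if "ae (\<lambda>\<psi>. f \<psi> = h \<psi>)"
      by (rule ae_mono[OF ae_conj[OF fg that] fin_dep_comp2[OF g \<open>fin_dep B E h\<close>]]) metis
    show "ae (\<lambda>\<psi>. f \<psi> = h \<psi>)" if "ae (\<lambda>\<psi>. g \<psi> = h \<psi>)"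
      by (rule ae_mono[OF ae_conj[OF fg that] fin_dep_comp2[OF f \<open>fin_dep B E h\<close>]]) metis
  qed
  then show "ucls B E L f = ucls B E L g"
    unfolding ucls_def ae_def cyl_maps_iff by blast
qed

end

section \<open>Elements of the cylindrical ultrapower\<close>

locale ultrapower = lim_rim_over B E L
  for B :: "'b set" and E :: "'e set" and L :: "('e \<Rightarrow> 'b) set set" +
  fixes \<kappa> :: "'k rel"
  assumes basis_is_set: "|B| <o \<kappa>"
begin

lemma star_mapsD:
  assumes "f \<in> star_maps \<kappa> B E X"
  shows "fin_dep B E f" and "\<psi> \<in> E \<rightarrow>\<^sub>E B \<Longrightarrow> f \<psi> \<in> X"
  using assms unfolding star_maps_def by (auto simp: cyl_maps_iff PiE_iff)

text \<open>
  The map factors through its own range, which has at most \<open>|B| < \<kappa>\<close> elements, so every such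
  map into a class is a map into a set.
\<close>

lemma star_mapsI:
  assumes f: "fin_dep B E f" and X: "\<And>\<psi>. \<psi> \<in> E \<rightarrow>\<^sub>E B \<Longrightarrow> f \<psi> \<in> X"
  shows "restrict f (E \<rightarrow>\<^sub>E B) \<in> star_maps \<kappa> B E X"
proof -
  let ?A = "f ` (E \<rightarrow>\<^sub>E B)"
  have "is_set \<kappa> ?A"
    unfolding is_set_def
    by (rule ordLeq_ordLess_trans[OF fin_dep_card_image[OF infinite_basis f] basis_is_set])
  moreover have "?A \<subseteq> X" using X by blast
  moreover have "restrict f (E \<rightarrow>\<^sub>E B) \<in> cyl_maps B E ?A"
    using f fin_dep_cong[of E B "restrict f (E \<rightarrow>\<^sub>E B)" f] unfolding cyl_maps_iff by auto
  ultimately show ?thesis unfolding star_maps_def by blast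
qed

lemma ucls_restrict: "fin_dep B E f \<Longrightarrow> ucls B E L (restrict f (E \<rightarrow>\<^sub>E B)) = ucls B E L f"
  using fin_dep_cong[of E B "restrict f (E \<rightarrow>\<^sub>E B)" f]
  by (subst ucls_eq_iff) (auto intro: ae_all)

lemma ucls_in_star:
  assumes "fin_dep B E f" "\<And>\<psi>. \<psi> \<in> E \<rightarrow>\<^sub>E B \<Longrightarrow> f \<psi> \<in> X"
  shows "ucls B E L f \<in> star \<kappa> B E L X"
  using star_mapsI[OF assms] ucls_restrict[OF assms(1)] unfolding star_def by (metis imageI)

lemma starE:
  assumes "x \<in> star \<kappa> B E L X"
  obtains f where "f \<in> star_maps \<kappa> B E X" "x = ucls B E L f"
  using assms unfolding star_def by blast

lemma star_mono: "A \<subseteq> X \<Longrightarrow> star \<kappa> B E L A \<subseteq> star \<kappa> B E L X"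
  unfolding star_def star_maps_def by blast

lemma star_confinement:
  assumes "x \<in> star \<kappa> B E L X"
  obtains A where "A \<subseteq> X" "is_set \<kappa> A" "|A| \<le>o |B|" "x \<in> star \<kappa> B E L A"
proof -
  obtain f where f: "f \<in> star_maps \<kappa> B E X" "x = ucls B E L f" by (rule starE[OF assms])
  let ?A = "f ` (E \<rightarrow>\<^sub>E B)"
  have le: "|?A| \<le>o |B|" by (rule fin_dep_card_image[OF infinite_basis star_mapsD(1)[OF f(1)]])
  show thesis
  proof (rule that)
    show "?A \<subseteq> X" using star_mapsD(2)[OF f(1)] by blast
    show "|?A| \<le>o |B|" by (rule le)
    show "is_set \<kappa> ?A" unfolding is_set_def by (rule ordLeq_ordLess_trans[OF le basis_is_set])
    show "x \<in> star \<kappa> B E L ?A" unfolding f(2) by (rule ucls_in_star[OF star_mapsD(1)[OF f(1)]]) simp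
  qed
qed

lemma star_rel2_iff:
  assumes f: "fin_dep B E f" "\<And>\<psi>. \<psi> \<in> E \<rightarrow>\<^sub>E B \<Longrightarrow> f \<psi> \<in> X"
    and g: "fin_dep B E g" "\<And>\<psi>. \<psi> \<in> E \<rightarrow>\<^sub>E B \<Longrightarrow> g \<psi> \<in> Y"
  shows "(ucls B E L f, ucls B E L g) \<in> star_rel2 \<kappa> B E L X Y R \<longleftrightarrow> ae (\<lambda>\<psi>. (f \<psi>, g \<psi>) \<in> R)"
proof
  assume "(ucls B E L f, ucls B E L g) \<in> star_rel2 \<kappa> B E L X Y R"
  then obtain f' g' where *: "ucls B E L f = ucls B E L f'" "ucls B E L g = ucls B E L g'"
    "f' \<in> star_maps \<kappa> B E X" "g' \<in> star_maps \<kappa> B E Y" "ae (\<lambda>\<psi>. (f' \<psi>, g' \<psi>) \<in> R)"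
    unfolding star_rel2_def ae_def by blast
  have "ae (\<lambda>\<psi>. f \<psi> = f' \<psi>)" using *(1) ucls_eq_iff[OF f(1) star_mapsD(1)[OF *(3)]] by simp
  moreover have "ae (\<lambda>\<psi>. g \<psi> = g' \<psi>)"
    using *(2) ucls_eq_iff[OF g(1) star_mapsD(1)[OF *(4)]] by simp
  ultimately show "ae (\<lambda>\<psi>. (f \<psi>, g \<psi>) \<in> R)"
    by (rule ae_mono[OF ae_conj[OF *(5) ae_conj] fin_dep_comp2[OF f(1) g(1)]]) metis
next
  assume *: "ae (\<lambda>\<psi>. (f \<psi>, g \<psi>) \<in> R)"
  let ?r = "\<lambda>h. restrict h (E \<rightarrow>\<^sub>E B)"
  have "ae (\<lambda>\<psi>. (?r f \<psi>, ?r g \<psi>) \<in> R)"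
    using * ae_cong[of "\<lambda>\<psi>. (f \<psi>, g \<psi>) \<in> R" "\<lambda>\<psi>. (?r f \<psi>, ?r g \<psi>) \<in> R"] by simp
  then have "(ucls B E L (?r f), ucls B E L (?r g)) \<in> star_rel2 \<kappa> B E L X Y R"
    unfolding star_rel2_def ae_def using star_mapsI[OF f] star_mapsI[OF g] by blast
  then show "(ucls B E L f, ucls B E L g) \<in> star_rel2 \<kappa> B E L X Y R"
    unfolding ucls_restrict[OF f(1)] ucls_restrict[OF g(1)] .
qed

lemma star_rel_iff:
  assumes "list_all2 (\<lambda>f X. f \<in> star_maps \<kappa> B E X) fs Xs"
  shows "map (ucls B E L) fs \<in> star_rel \<kappa> B E L Xs R \<longleftrightarrow> ae (\<lambda>\<psi>. map (\<lambda>f. f \<psi>) fs \<in> R)"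
proof
  have fd: "fin_dep B E f" if "f \<in> set gs" "list_all2 (\<lambda>f X. f \<in> star_maps \<kappa> B E X) gs Xs" for f gs
    using that star_mapsD(1) by (metis in_set_conv_nth list_all2_conv_all_nth)
  have fdm: "fin_dep B E (\<lambda>\<psi>. map (\<lambda>f. f \<psi>) fs \<in> R)"
  proof -
    have "fin_dep B E (\<lambda>\<psi>. map (restrict (\<lambda>f. f \<psi>) (set fs)) fs \<in> R)"
      by (rule fin_dep_comp[OF fin_dep_family, where h = "\<lambda>r. map r fs \<in> R"]) (use fd assms in auto)
    moreover have "map (restrict (\<lambda>f. f \<psi>) (set fs)) fs = map (\<lambda>f. f \<psi>) fs" for \<psi> by simp
    ultimately show ?thesis by (simp only:)
  qed
  assume "map (ucls B E L) fs \<in> star_rel \<kappa> B E L Xs R"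
  then obtain gs where gs: "map (ucls B E L) fs = map (ucls B E L) gs"
    "list_all2 (\<lambda>f X. f \<in> star_maps \<kappa> B E X) gs Xs" "ae (\<lambda>\<psi>. map (\<lambda>f. f \<psi>) gs \<in> R)"
    unfolding star_rel_def ae_def by blast
  have len: "length gs = length fs" using gs(1) by (metis length_map)
  have "ae (\<lambda>\<psi>. \<forall>i\<in>{..<length fs}. (fs ! i) \<psi> = (gs ! i) \<psi>)"
  proof (rule ae_ball)
    fix i assume i: "i \<in> {..<length fs}"
    have "ucls B E L (fs ! i) = ucls B E L (gs ! i)"
      using arg_cong[OF gs(1), of "\<lambda>l. l ! i"] i len by simp
    then show "ae (\<lambda>\<psi>. (fs ! i) \<psi> = (gs ! i) \<psi>)"
      using ucls_eq_iff[OF fd[OF _ assms] fd[OF _ gs(2)], of "fs ! i" "gs ! i"] i len by simp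
  qed simp
  from ae_conj[OF gs(3) this] show "ae (\<lambda>\<psi>. map (\<lambda>f. f \<psi>) fs \<in> R)"
  proof (rule ae_mono[OF _ fdm])
    fix \<psi> assume "map (\<lambda>f. f \<psi>) gs \<in> R \<and> (\<forall>i\<in>{..<length fs}. (fs ! i) \<psi> = (gs ! i) \<psi>)"
    moreover from this have "map (\<lambda>f. f \<psi>) fs = map (\<lambda>f. f \<psi>) gs"
      using len by (intro nth_equalityI) auto
    ultimately show "map (\<lambda>f. f \<psi>) fs \<in> R" by simp
  qed
next
  assume "ae (\<lambda>\<psi>. map (\<lambda>f. f \<psi>) fs \<in> R)"
  then show "map (ucls B E L) fs \<in> star_rel \<kappa> B E L Xs R"
    using assms unfolding star_rel_def ae_def by blast
qed

section \<open>The theorem of Los\<close>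

lemma finite_free_vars: "finite (free_vars p)"
  by (induction p) auto

lemma fin_dep_sat:
  assumes "\<And>v. v \<in> free_vars p \<Longrightarrow> fin_dep B E (fa v)"
  shows "fin_dep B E (\<lambda>\<psi>. sat X P (\<lambda>v. fa v \<psi>) p)"
proof -
  have "fin_dep B E (\<lambda>\<psi>. sat X P (restrict (\<lambda>v. fa v \<psi>) (free_vars p)) p)"
    by (rule fin_dep_comp[OF fin_dep_family[OF finite_free_vars assms]])
  moreover have "sat X P (restrict (\<lambda>v. fa v \<psi>) (free_vars p)) p = sat X P (\<lambda>v. fa v \<psi>) p" for \<psi>
    by (rule sat_cong_free_vars) simp
  ultimately show ?thesis by (simp only:)
qed

theorem los:
  assumes "well_sorted ar p"
    and "\<And>v. v \<in> free_vars p \<Longrightarrow> fa v \<in> star_maps \<kappa> B E (X (fst v))"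
  shows "sat (\<lambda>s. star \<kappa> B E L (X s)) (\<lambda>r. star_rel \<kappa> B E L (map X (ar r)) (P r))
      (\<lambda>v. ucls B E L (fa v)) p \<longleftrightarrow> ae (\<lambda>\<psi>. sat X P (\<lambda>v. fa v \<psi>) p)"
  using assms
proof (induction p arbitrary: fa)
  case (Eq u v)
  then show ?case using ucls_eq_iff[of "fa u" "fa v"] star_mapsD(1) by fastforce
next
  case (Rel r vs)
  have "list_all2 (\<lambda>f X. f \<in> star_maps \<kappa> B E X) (map fa vs) (map X (ar r))"
    unfolding Rel.prems(1)[unfolded well_sorted.simps, symmetric]
    using Rel.prems(2) by (simp add: list_all2_map1 list_all2_map2 list_all2_same del: split_paired_All)
  from star_rel_iff[OF this] show ?case by (simp add: comp_def)
next
  case (Neg p)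
  have "fin_dep B E (\<lambda>\<psi>. sat X P (\<lambda>v. fa v \<psi>) p)"
    using Neg.prems(2) star_mapsD(1) by (intro fin_dep_sat) fastforce
  from ae_not[OF this] show ?case using Neg.IH[of fa] Neg.prems by simp
next
  case (Conj p q)
  have p: "fin_dep B E (\<lambda>\<psi>. sat X P (\<lambda>v. fa v \<psi>) p)"
    and q: "fin_dep B E (\<lambda>\<psi>. sat X P (\<lambda>v. fa v \<psi>) q)"
    using Conj.prems(2) star_mapsD(1) by (auto intro!: fin_dep_sat)
  have "ae (\<lambda>\<psi>. sat X P (\<lambda>v. fa v \<psi>) p \<and> sat X P (\<lambda>v. fa v \<psi>) q) \<longleftrightarrow>
      ae (\<lambda>\<psi>. sat X P (\<lambda>v. fa v \<psi>) p) \<and> ae (\<lambda>\<psi>. sat X P (\<lambda>v. fa v \<psi>) q)"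
    using ae_conj ae_mono[OF _ p] ae_mono[OF _ q] by blast
  then show ?case using Conj.IH[of fa] Conj.prems by simp
next
  case (Exi v p)
  let ?S = "\<lambda>s. star \<kappa> B E L (X s)" and ?Q = "\<lambda>r. star_rel \<kappa> B E L (map X (ar r)) (P r)"
  have upd: "(\<lambda>w. ucls B E L (fa w))(v := ucls B E L f) = (\<lambda>w. ucls B E L ((fa(v := f)) w))" for f
    by (rule ext) simp
  have upd': "(\<lambda>w. (fa(v := f)) w \<psi>) = (\<lambda>w. fa w \<psi>)(v := f \<psi>)" for f \<psi>
    by (rule ext) simp
  have IH: "sat ?S ?Q ((\<lambda>w. ucls B E L (fa w))(v := ucls B E L f)) p \<longleftrightarrow>
      ae (\<lambda>\<psi>. sat X P ((\<lambda>w. fa w \<psi>)(v := f \<psi>)) p)" if "f \<in> star_maps \<kappa> B E (X (fst v))" for f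
    unfolding upd upd'[symmetric] by (rule Exi.IH) (use Exi.prems that in auto)
  have fd: "fin_dep B E (fa w)" if "w \<in> free_vars (Exi v p)" for w
    using Exi.prems(2)[OF that] star_mapsD(1) by blast
  show ?case
  proof
    assume "sat ?S ?Q (\<lambda>w. ucls B E L (fa w)) (Exi v p)"
    then obtain x where x: "x \<in> star \<kappa> B E L (X (fst v))" "sat ?S ?Q ((\<lambda>w. ucls B E L (fa w))(v := x)) p"
      by auto
    obtain f where f: "f \<in> star_maps \<kappa> B E (X (fst v))" "x = ucls B E L f" by (rule starE[OF x(1)])
    have "ae (\<lambda>\<psi>. sat X P ((\<lambda>w. fa w \<psi>)(v := f \<psi>)) p)" using IH[OF f(1)] x(2) f(2) by simp
    then show "ae (\<lambda>\<psi>. sat X P (\<lambda>w. fa w \<psi>) (Exi v p))"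
      by (rule ae_mono[OF _ fin_dep_sat[OF fd]]) (use star_mapsD(2)[OF f(1)] in auto)
  next
    assume *: "ae (\<lambda>\<psi>. sat X P (\<lambda>w. fa w \<psi>) (Exi v p))"
    then obtain x0 where x0: "x0 \<in> X (fst v)" using ae_ex[OF *] by auto
    \<comment> \<open>The witness is a function of the values of the free variables alone; at assignments without
      a witness it is the arbitrary element \<open>x0\<close>.\<close>
    let ?ok = "\<lambda>a x. x \<in> X (fst v) \<and> sat X P (a(v := x)) p"
    define ch where "ch a = (if \<exists>x. ?ok a x then SOME x. ?ok a x else x0)" for a
    have ok: "?ok a (ch a)" if "sat X P a (Exi v p)" for a
      using that someI_ex[of "?ok a"] unfolding ch_def by auto
    have chX: "ch a \<in> X (fst v)" for a
      using someI_ex[of "?ok a"] x0 unfolding ch_def by auto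
    define f where "f \<psi> = ch (restrict (\<lambda>w. fa w \<psi>) (free_vars (Exi v p)))" for \<psi>
    have f: "fin_dep B E f"
      unfolding f_def by (rule fin_dep_comp[OF fin_dep_family[OF finite_free_vars fd]])
    let ?f = "restrict f (E \<rightarrow>\<^sub>E B)"
    have f': "?f \<in> star_maps \<kappa> B E (X (fst v))"
      by (rule star_mapsI[OF f]) (simp add: f_def chX)
    have "ae (\<lambda>\<psi>. sat X P ((\<lambda>w. fa w \<psi>)(v := ?f \<psi>)) p)"
    proof (rule ae_mono[OF *])
      show "fin_dep B E (\<lambda>\<psi>. sat X P ((\<lambda>w. fa w \<psi>)(v := ?f \<psi>)) p)"
        unfolding upd'[symmetric] by (rule fin_dep_sat) (use fd star_mapsD(1)[OF f'] in auto)
      fix \<psi> assume \<psi>: "\<psi> \<in> E \<rightarrow>\<^sub>E B" "sat X P (\<lambda>w. fa w \<psi>) (Exi v p)"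
      let ?a = "restrict (\<lambda>w. fa w \<psi>) (free_vars (Exi v p))"
      have "sat X P ?a (Exi v p)"
        using \<psi>(2) sat_cong_free_vars[of "Exi v p" ?a "\<lambda>w. fa w \<psi>"] by auto
      then have "sat X P (?a(v := f \<psi>)) p" using ok unfolding f_def by blast
      moreover have "sat X P (?a(v := f \<psi>)) p = sat X P ((\<lambda>w. fa w \<psi>)(v := f \<psi>)) p"
        by (rule sat_cong_free_vars) simp
      ultimately show "sat X P ((\<lambda>w. fa w \<psi>)(v := ?f \<psi>)) p" using \<psi>(1) by simp
    qed
    then have "sat ?S ?Q ((\<lambda>w. ucls B E L (fa w))(v := ucls B E L ?f)) p" using IH[OF f'] by simp
    moreover have "ucls B E L ?f \<in> star \<kappa> B E L (X (fst v))" using f' unfolding star_def by blast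
    ultimately show "sat ?S ?Q (\<lambda>w. ucls B E L (fa w)) (Exi v p)" by auto
  qed
qed

text \<open>
  A sentence has no free variables, so the assignment may be constantly undefined.
\<close>

corollary transfer_principle:
  assumes p: "sentence ar p" and true: "true_in X P p"
  shows "true_in (\<lambda>s. star \<kappa> B E L (X s)) (\<lambda>r. star_rel \<kappa> B E L (map X (ar r)) (P r)) p"
proof -
  let ?a = "\<lambda>_ _. undefined"
  have "ae (\<lambda>\<psi>. sat X P (\<lambda>v. ?a v \<psi>) p)"
    using true unfolding true_in_def by (intro ae_all) blast
  then have "sat (\<lambda>s. star \<kappa> B E L (X s)) (\<lambda>r. star_rel \<kappa> B E L (map X (ar r)) (P r))
      (\<lambda>v. ucls B E L (?a v)) p"
    using los[of ar p ?a X P] p unfolding sentence_def by simp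
  then show ?thesis by (rule iffD2[OF true_in_iff_sat[OF p]])
qed

end

section \<open>Cardinalities of finite subsets and of functions\<close>

lemma cylinders_finite_index:
  assumes "finite I" "C \<subseteq> I \<rightarrow>\<^sub>E B"
  shows "C \<in> cylinders B I"
proof -
  have "fin_dep B I (\<lambda>\<phi>. \<phi> \<in> C)"
  proof (rule fin_depI[OF subset_refl assms(1)])
    fix \<phi> \<phi>' assume "\<phi> \<in> I \<rightarrow>\<^sub>E B" "\<phi>' \<in> I \<rightarrow>\<^sub>E B" "\<And>i. i \<in> I \<Longrightarrow> \<phi> i = \<phi>' i"
    then have "\<phi> = \<phi>'" by (rule PiE_ext)
    then show "(\<phi> \<in> C) = (\<phi>' \<in> C)" by simp
  qed
  then show ?thesis using assms(2) unfolding cylinders_iff by blast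
qed

lemma finite_subsets_card:
  fixes B :: "'b set" and F :: "'a set"
  assumes "infinite B" "|F| \<le>o |B|"
  shows "|{G. G \<subseteq> F \<and> finite G}| \<le>o |B|"
proof -
  have step: "|{G. G \<subseteq> F \<and> finite G \<and> card G = n}| \<le>o |B|" for n
  proof (induction n)
    case 0
    have "{G. G \<subseteq> F \<and> finite G \<and> card G = 0} = {{}}" by auto
    moreover have "|{{} :: 'a set}| \<le>o |B|" using assms(1) by (intro card_of_singl_ordLeq) auto
    ultimately show ?case by (simp only:)
  next
    case (Suc n)
    let ?H = "{G. G \<subseteq> F \<and> finite G \<and> card G = n}"
    have "{G. G \<subseteq> F \<and> finite G \<and> card G = Suc n} \<subseteq> (\<lambda>(x, G). insert x G) ` (F \<times> ?H)"
    proof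
      fix G assume G: "G \<in> {G. G \<subseteq> F \<and> finite G \<and> card G = Suc n}"
      then obtain x where x: "x \<in> G" by fastforce
      then have "G = insert x (G - {x})" "x \<in> F" "G - {x} \<in> ?H" using G by auto
      then show "G \<in> (\<lambda>(x, G). insert x G) ` (F \<times> ?H)" by (metis (no_types, lifting) SigmaI case_prod_conv imageI)
    qed
    moreover have "|F \<times> ?H| \<le>o |B|"
      by (rule card_of_Times_ordLeq_infinite_Field[OF _ assms(2) Suc.IH card_of_Card_order])
        (simp add: assms(1) Field_card_of)
    ultimately show ?case by (rule ordLeq_transitive[OF surj_imp_ordLeq])
  qed
  have "{G. G \<subseteq> F \<and> finite G} = (\<Union>n\<in>UNIV. {G. G \<subseteq> F \<and> finite G \<and> card G = n})" by auto
  moreover have "|\<Union>n\<in>(UNIV :: nat set). {G. G \<subseteq> F \<and> finite G \<and> card G = n}| \<le>o |B|"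
    by (rule card_of_UNION_ordLeq_infinite[OF assms(1)])
      (use assms(1) infinite_iff_card_of_nat step in auto)
  ultimately show ?thesis by simp
qed

text \<open>
  With \<open>X\<close> embedded into \<open>Pow (Pow B)\<close>, a function \<open>B \<rightarrow> X\<close> is determined by a subset of
  \<open>B \<times> Pow B\<close>, and \<open>|B \<times> Pow B| \<le> |Pow B|\<close>.
\<close>

lemma card_functions_le:
  assumes "infinite B" "|X| \<le>o |Pow (Pow B)|"
  shows "|B \<rightarrow>\<^sub>E X| \<le>o |Pow (Pow B)|"
proof -
  obtain h where h: "inj_on h X" "h ` X \<subseteq> Pow (Pow B)"
    using card_of_ordLeq[THEN iffD2, OF assms(2)] by blast
  have inj: "inj_on (\<lambda>g. SIGMA b:B. h (g b)) (B \<rightarrow>\<^sub>E X)"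
  proof (rule inj_onI)
    fix g g' assume g: "g \<in> B \<rightarrow>\<^sub>E X" "g' \<in> B \<rightarrow>\<^sub>E X" and eq: "(SIGMA b:B. h (g b)) = (SIGMA b:B. h (g' b))"
    show "g = g'"
    proof (rule PiE_ext[OF g])
      fix b assume b: "b \<in> B"
      have "h (g b) = (SIGMA b:B. h (g b)) `` {b}" using b by auto
      also have "\<dots> = h (g' b)" unfolding eq using b by auto
      finally show "g b = g' b" using inj_onD[OF h(1)] g b by (meson PiE_mem)
    qed
  qed
  have "h (g b) \<subseteq> Pow B" if "g \<in> B \<rightarrow>\<^sub>E X" "b \<in> B" for g b
    using h(2) PiE_mem[OF that] by blast
  then have "(\<lambda>g. SIGMA b:B. h (g b)) ` (B \<rightarrow>\<^sub>E X) \<subseteq> Pow (B \<times> Pow B)"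
    by (intro image_subsetI PowI Sigma_mono) simp_all
  from card_of_ordLeq[THEN iffD1, OF exI, OF conjI, OF inj this]
  have "|B \<rightarrow>\<^sub>E X| \<le>o |Pow (B \<times> Pow B)|" .
  moreover have "|B \<times> Pow B| \<le>o |Pow B|"
    by (rule card_of_Times_ordLeq_infinite_Field[OF _ _ ordLeq_refl[OF card_of_Card_order] card_of_Card_order])
      (simp_all add: assms(1) Field_card_of ordLess_imp_ordLeq[OF card_of_Pow] finite_Pow_iff)
  then have "|Pow (B \<times> Pow B)| \<le>o |Pow (Pow B)|"
  proof -
    obtain k where k: "inj_on k (B \<times> Pow B)" "k ` (B \<times> Pow B) \<subseteq> Pow B"
      using card_of_ordLeq[THEN iffD2, OF \<open>|B \<times> Pow B| \<le>o |Pow B|\<close>] by blast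
    have "inj_on (image k) (Pow (B \<times> Pow B))" by (rule inj_on_image_Pow[OF k(1)])
    moreover have "image k ` Pow (B \<times> Pow B) \<subseteq> Pow (Pow B)" using k(2) by blast
    ultimately show ?thesis by (rule card_of_ordLeq[THEN iffD1, OF exI, OF conjI])
  qed
  ultimately show ?thesis by (rule ordLeq_transitive)
qed

section \<open>Exactness and saturation\<close>

context lim_rim_over
begin

text \<open>
  Let \<open>f\<close> depend on the coordinates in \<open>J\<close>. The joint type of the coordinates in \<open>J\<close> and of \<open>f\<close>
  extends the type of the coordinates in \<open>J\<close>; the element of \<open>E\<close> that realizes it over \<open>J\<close> is the
  coordinate sought, since the type contains the graph of \<open>f\<close>.
\<close>

lemma coordinate_representation:
  assumes exact: "exact_for natLeq B E L"
    and f: "fin_dep B E f" "\<And>\<psi>. \<psi> \<in> E \<rightarrow>\<^sub>E B \<Longrightarrow> f \<psi> \<in> B"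
  obtains e where "e \<in> E" "ae (\<lambda>\<psi>. \<psi> e = f \<psi>)"
proof -
  obtain J where J: "J \<subseteq> E" "finite J"
    and feq: "\<And>\<psi> \<psi>'. \<psi> \<in> E \<rightarrow>\<^sub>E B \<Longrightarrow> \<psi>' \<in> E \<rightarrow>\<^sub>E B \<Longrightarrow> (\<And>j. j \<in> J \<Longrightarrow> \<psi> j = \<psi>' j) \<Longrightarrow> f \<psi> = f \<psi>'"
    by (fact fin_depE[OF f(1)])
  obtain h where h: "bij_betw h {0..<card J} J" using ex_bij_betw_nat_finite[OF J(2)] by blast
  define n where "n = card J"
  define I where "I = {0..<n}"
  have hI: "h ` I = J" using h unfolding bij_betw_def I_def n_def by blast
  have nI: "n \<notin> I" and finI: "finite I" unfolding I_def by auto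
  define T where "T \<psi> = (\<lambda>k\<in>insert n I. if k = n then f \<psi> else \<psi> (h k))" for \<psi>
  have hE: "h k \<in> E" if "k \<in> I" for k using that hI J(1) by blast
  have T1: "T \<psi> \<in> insert n I \<rightarrow>\<^sub>E B" if "\<psi> \<in> E \<rightarrow>\<^sub>E B" for \<psi>
    unfolding T_def using that hE f(2)[OF that] by auto
  have T2: "fin_dep B E (\<lambda>\<psi>. T \<psi> k)" if "k \<in> insert n I" for k
  proof (cases "k = n")
    case True
    then show ?thesis using f(1) unfolding T_def by simp
  next
    case False
    then show ?thesis using fin_dep_coord[OF hE, of k] that unfolding T_def by simp
  qed
  define U where "U = {C \<in> cylinders B (insert n I). {\<psi> \<in> E \<rightarrow>\<^sub>E B. T \<psi> \<in> C} \<in> L}"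
  have U: "cyl_ultrafilter B (insert n I) U"
    unfolding U_def by (rule cyl_ultrafilter_vimage[OF ultra T1 T2])
  have Tr: "restrict (T \<psi>) I = compose I \<psi> h" for \<psi>
    unfolding T_def compose_def using nI by (auto simp: restrict_def fun_eq_iff)
  have proj: "projection B (insert n I) U I = pull B E L I h"
  proof -
    have "{\<phi> \<in> insert n I \<rightarrow>\<^sub>E B. restrict \<phi> I \<in> C} \<in> U \<longleftrightarrow> {\<psi> \<in> E \<rightarrow>\<^sub>E B. compose I \<psi> h \<in> C} \<in> L"
      if "C \<in> cylinders B I" for C
    proof -
      have "{\<phi> \<in> insert n I \<rightarrow>\<^sub>E B. restrict \<phi> I \<in> C} \<in> cylinders B (insert n I)"
        by (rule cylinders_finite_index) (use finI in auto)
      moreover have "{\<psi> \<in> E \<rightarrow>\<^sub>E B. T \<psi> \<in> {\<phi> \<in> insert n I \<rightarrow>\<^sub>E B. restrict \<phi> I \<in> C}} =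
          {\<psi> \<in> E \<rightarrow>\<^sub>E B. compose I \<psi> h \<in> C}"
        using T1 Tr by auto
      ultimately show ?thesis unfolding U_def by simp
    qed
    then show ?thesis unfolding projection_def pull_def by blast
  qed
  obtain \<eta>' where \<eta>': "\<eta>' \<in> insert n I \<rightarrow> E" "\<forall>j\<in>I. \<eta>' j = h j" "pull B E L (insert n I) \<eta>' = U"
    using exact[unfolded exact_for_def, rule_format, OF finI[unfolded finite_iff_ordLess_natLeq] nI _ U proj] hE
    by blast
  \<comment> \<open>The graph of \<open>f\<close>, as a cylinder in the finitely many indices.\<close>
  let ?C = "T ` (E \<rightarrow>\<^sub>E B)"
  have "?C \<in> cylinders B (insert n I)" by (rule cylinders_finite_index) (use finI T1 in auto)
  moreover have "{\<psi> \<in> E \<rightarrow>\<^sub>E B. T \<psi> \<in> ?C} = E \<rightarrow>\<^sub>E B" by auto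
  ultimately have "?C \<in> U" unfolding U_def using cyl_ultrafilterD(2)[OF ultra] by simp
  then have C: "ae (\<lambda>\<psi>. compose (insert n I) \<psi> \<eta>' \<in> ?C)"
    unfolding \<eta>'(3)[symmetric] pull_def ae_def by simp
  show thesis
  proof (rule that)
    show e: "\<eta>' n \<in> E" using \<eta>'(1) by auto
    show "ae (\<lambda>\<psi>. \<psi> (\<eta>' n) = f \<psi>)"
    proof (rule ae_mono[OF C fin_dep_comp2[OF fin_dep_coord[OF e] f(1)]])
      fix \<psi> assume \<psi>: "\<psi> \<in> E \<rightarrow>\<^sub>E B" "compose (insert n I) \<psi> \<eta>' \<in> ?C"
      then obtain \<psi>' where \<psi>': "\<psi>' \<in> E \<rightarrow>\<^sub>E B" and eq: "compose (insert n I) \<psi> \<eta>' = T \<psi>'" by blast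
      have "\<psi> (\<eta>' n) = f \<psi>'" using fun_cong[OF eq, of n] unfolding T_def compose_def by simp
      moreover have "f \<psi> = f \<psi>'"
      proof (rule feq[OF \<psi>(1) \<psi>'])
        fix j assume "j \<in> J"
        then obtain k where k: "k \<in> I" "j = h k" using hI by blast
        then have "k \<noteq> n" using nI by blast
        then show "\<psi> j = \<psi>' j"
          using fun_cong[OF eq, of k] k \<eta>'(2) unfolding T_def compose_def by simp
      qed
      ultimately show "\<psi> (\<eta>' n) = f \<psi>" by simp
    qed
  qed
qed

text \<open>
  Saturation of \<open>E\<close> in one unknown for families indexed by \<open>K\<close>. Indexing by an arbitrary set \<open>K\<close>
  lets the families be indexed by internal sets, by elements of an ultrapower or by subsets of \<open>B\<close>.
\<close>

definition binary_saturated :: "'i set \<Rightarrow> bool" where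
  "binary_saturated K \<longleftrightarrow> (\<forall>(R :: 'i \<Rightarrow> ('b \<times> 'b) set) e. (\<forall>k\<in>K. e k \<in> E) \<longrightarrow>
     (\<forall>G. G \<subseteq> K \<longrightarrow> finite G \<longrightarrow> (\<exists>x\<in>E. \<forall>k\<in>G. ae (\<lambda>\<psi>. (\<psi> x, \<psi> (e k)) \<in> R k))) \<longrightarrow>
     (\<exists>x\<in>E. \<forall>k\<in>K. ae (\<lambda>\<psi>. (\<psi> x, \<psi> (e k)) \<in> R k)))"

lemma binary_saturatedD:
  assumes "binary_saturated K" "\<And>k. k \<in> K \<Longrightarrow> e k \<in> E"
    and "\<And>G. G \<subseteq> K \<Longrightarrow> finite G \<Longrightarrow> \<exists>x\<in>E. \<forall>k\<in>G. ae (\<lambda>\<psi>. (\<psi> x, \<psi> (e k)) \<in> R k)"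
  shows "\<exists>x\<in>E. \<forall>k\<in>K. ae (\<lambda>\<psi>. (\<psi> x, \<psi> (e k)) \<in> R k)"
  using assms(1)[unfolded binary_saturated_def, rule_format, OF assms(2,3)] .

lemma saturated_imp_binary_saturated:
  fixes K :: "'i set"
  assumes sat: "saturated_for m B E L" and K: "|K| <o m"
  shows "binary_saturated K"
  unfolding binary_saturated_def
proof (intro allI impI)
  fix R :: "'i \<Rightarrow> ('b \<times> 'b) set" and e
  assume e: "\<forall>k\<in>K. e k \<in> E"
    and fip: "\<forall>G. G \<subseteq> K \<longrightarrow> finite G \<longrightarrow> (\<exists>x\<in>E. \<forall>k\<in>G. ae (\<lambda>\<psi>. (\<psi> x, \<psi> (e k)) \<in> R k))"
  define Q where "Q k = {[u, v] | u v. u \<in> B \<and> v \<in> B \<and> (u, v) \<in> R k}" for k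
  define D where "D k = {x. length x = 1 \<and> set x \<subseteq> E \<and> x @ [e k] \<in> lr_rel B E L (Suc 1) (Q k)}" for k
  have D: "[x] \<in> D k \<longleftrightarrow> ae (\<lambda>\<psi>. (\<psi> x, \<psi> (e k)) \<in> R k)" if "k \<in> K" "x \<in> E" for x k
  proof -
    have "ae (\<lambda>\<psi>. map \<psi> [x, e k] \<in> Q k) \<longleftrightarrow> ae (\<lambda>\<psi>. (\<psi> x, \<psi> (e k)) \<in> R k)"
      by (rule ae_cong) (use that e in \<open>auto simp: Q_def\<close>)
    then show ?thesis using that e unfolding D_def lr_rel_def ae_def by simp
  qed
  have sing: "\<exists>x\<in>E. y = [x]" if "length y = 1" "set y \<subseteq> E" for y
    using that by (cases y) auto
  have DF: "D ` K \<subseteq> {{x. length x = 1 \<and> set x \<subseteq> E \<and> x @ [e] \<in> lr_rel B E L (Suc 1) R} | R e.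
                   R \<subseteq> {bs. length bs = Suc 1 \<and> set bs \<subseteq> B} \<and> e \<in> E}"
  proof
    fix S assume "S \<in> D ` K"
    then obtain k where k: "k \<in> K" "S = D k" by blast
    have "Q k \<subseteq> {bs. length bs = Suc 1 \<and> set bs \<subseteq> B}" unfolding Q_def by auto
    then show "S \<in> {{x. length x = 1 \<and> set x \<subseteq> E \<and> x @ [e] \<in> lr_rel B E L (Suc 1) R} | R e.
                   R \<subseteq> {bs. length bs = Suc 1 \<and> set bs \<subseteq> B} \<and> e \<in> E}"
      using k e unfolding D_def by blast
  qed
  have D_fip: "{x. length x = 1 \<and> set x \<subseteq> E} \<inter> \<Inter>G \<noteq> {}" if G: "G \<subseteq> D ` K" "finite G" for G
  proof -
    obtain H where H: "H \<subseteq> K" "finite H" "G = D ` H" using finite_subset_image[OF G(2,1)] by blast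
    obtain x where x: "x \<in> E" "\<forall>k\<in>H. ae (\<lambda>\<psi>. (\<psi> x, \<psi> (e k)) \<in> R k)"
      using fip H(1,2) by blast
    then have "\<forall>k\<in>H. [x] \<in> D k" using D H(1) by blast
    then have "[x] \<in> {x. length x = 1 \<and> set x \<subseteq> E} \<inter> \<Inter>G" using x(1) H(3) by simp
    then show "{x. length x = 1 \<and> set x \<subseteq> E} \<inter> \<Inter>G \<noteq> {}" by blast
  qed
  have "{x. length x = 1 \<and> set x \<subseteq> E} \<inter> \<Inter>(D ` K) \<noteq> {}"
    by (rule sat[unfolded saturated_for_def, rule_format, OF DF
          ordLeq_ordLess_trans[OF card_of_image K] D_fip])
  then obtain y where y: "length y = 1" "set y \<subseteq> E" "\<forall>k\<in>K. y \<in> D k" by blast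
  obtain x where "x \<in> E" "y = [x]" using sing[OF y(1,2)] by blast
  then show "\<exists>x\<in>E. \<forall>k\<in>K. ae (\<lambda>\<psi>. (\<psi> x, \<psi> (e k)) \<in> R k)" using y(3) D by blast
qed

text \<open>
  Finite solvability in \<open>E\<close> gives the finite intersection property of the conditions on a new
  index together with the pulled back cylinders of the type of the parameters. An ultrafilter that
  contains them all projects to the type of the parameters, because one ultrafilter cannot properly
  contain another, and exactness realizes it by an element of \<open>E\<close>.
\<close>

lemma exact_imp_binary_saturated:
  fixes K :: "'i set"
  assumes exact: "exact_for (cardSuc |Pow B| ) B E L" and K: "|K| \<le>o |Pow B|"
  shows "binary_saturated K"
  unfolding binary_saturated_def
proof (intro allI impI)
  fix R :: "'i \<Rightarrow> ('b \<times> 'b) set" and e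
  assume e: "\<forall>k\<in>K. e k \<in> E"
    and fip: "\<forall>G. G \<subseteq> K \<longrightarrow> finite G \<longrightarrow> (\<exists>x\<in>E. \<forall>k\<in>G. ae (\<lambda>\<psi>. (\<psi> x, \<psi> (e k)) \<in> R k))"
  obtain h :: "'i \<Rightarrow> 'b set" where h: "inj_on h K"
    using card_of_ordLeq[THEN iffD2, OF K] by blast
  \<comment> \<open>The old indices are singletons, which leaves \<open>{}\<close> as the new index.\<close>
  define \<iota> where "\<iota> k = {h k}" for k
  define I where "I = \<iota> ` K"
  have inj: "inj_on \<iota> K" using h unfolding \<iota>_def inj_on_def by simp
  define \<eta> where "\<eta> i = e (the_inv_into K \<iota> i)" for i
  have \<eta>\<iota>: "\<eta> (\<iota> k) = e k" if "k \<in> K" for k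
    unfolding \<eta>_def by (simp add: the_inv_into_f_f[OF inj that])
  have \<eta>E: "\<eta> \<in> I \<rightarrow> E" using \<eta>\<iota> e unfolding I_def by auto
  have new: "{} \<notin> I" unfolding I_def \<iota>_def by auto
  let ?I = "insert {} I"
  have I: "|I| <o cardSuc |Pow B|"
    unfolding cardSuc_ordLeq_ordLess[OF card_of_Card_order card_of_Card_order] I_def
    by (rule ordLeq_transitive[OF card_of_image K])
  have res: "restrict \<phi> I \<in> I \<rightarrow>\<^sub>E B" if "\<phi> \<in> ?I \<rightarrow>\<^sub>E B" for \<phi> :: "'b set set \<Rightarrow> 'b" using that by auto
  have resf: "fin_dep B ?I (\<lambda>\<phi>. restrict \<phi> I i)" if "i \<in> I" for i
    using that fin_dep_coord[of i ?I B] by simp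
  have com: "compose I \<psi> \<eta> \<in> I \<rightarrow>\<^sub>E B" if "\<psi> \<in> E \<rightarrow>\<^sub>E B" for \<psi>
    using that \<eta>E by (auto simp: compose_def)
  have comf: "fin_dep B E (\<lambda>\<psi>. compose I \<psi> \<eta> i)" if "i \<in> I" for i
    using fin_dep_coord[OF funcset_mem[OF \<eta>E that]] that by (simp add: compose_def)
  define old where "old C = {\<phi> \<in> ?I \<rightarrow>\<^sub>E B. restrict \<phi> I \<in> C}" for C
  define cond where "cond k = {\<phi> \<in> ?I \<rightarrow>\<^sub>E B. (\<phi> {}, \<phi> (\<iota> k)) \<in> R k}" for k
  let ?S = "old ` pull B E L I \<eta> \<union> cond ` K"
  have cyl: "?S \<subseteq> cylinders B ?I"
  proof -
    have "old C \<in> cylinders B ?I" if "C \<in> pull B E L I \<eta>" for C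
      unfolding old_def using that cylinders_vimage[OF _ res resf] unfolding pull_def by blast
    moreover have "cond k \<in> cylinders B ?I" if "k \<in> K" for k
      unfolding cond_def Collect_cylinders_iff
      by (rule fin_dep_comp2) (use that in \<open>auto simp: I_def\<close>)
    ultimately show ?thesis by blast
  qed
  have S_fip: "(?I \<rightarrow>\<^sub>E B) \<inter> \<Inter>G \<noteq> {}" if G: "G \<subseteq> ?S" "finite G" for G
  proof -
    obtain H where H: "H \<subseteq> K" "finite H" "G \<inter> cond ` K = cond ` H"
      using finite_subset_image[of "G \<inter> cond ` K" cond K] G(2) by blast
    obtain x where x: "x \<in> E" "\<forall>k\<in>H. ae (\<lambda>\<psi>. (\<psi> x, \<psi> (e k)) \<in> R k)"
      using fip H(1,2) by blast
    define T where "T \<psi> = (\<lambda>i\<in>?I. if i = {} then \<psi> x else \<psi> (\<eta> i))" for \<psi> :: "'e \<Rightarrow> 'b"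
    have T1: "T \<psi> \<in> ?I \<rightarrow>\<^sub>E B" if "\<psi> \<in> E \<rightarrow>\<^sub>E B" for \<psi>
      using PiE_mem[OF that x(1)] PiE_mem[OF that funcset_mem[OF \<eta>E]] unfolding T_def by auto
    have Tr: "restrict (T \<psi>) I = compose I \<psi> \<eta>" for \<psi>
      unfolding T_def compose_def using new by (auto simp: restrict_def fun_eq_iff)
    have Tc: "T \<psi> {} = \<psi> x" "T \<psi> (\<iota> k) = \<psi> (e k)" if "k \<in> K" for \<psi> k
      using that \<eta>\<iota>[OF that] unfolding T_def I_def by (auto simp: \<iota>_def)
    have "ae (\<lambda>\<psi>. T \<psi> \<in> D)" if "D \<in> G" for D
    proof (cases "D \<in> cond ` K")
      case True
      then have "D \<in> cond ` H" unfolding H(3)[symmetric] using that by simp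
      then obtain k where k: "k \<in> H" "D = cond k" by blast
      have kK: "k \<in> K" using k(1) H(1) by blast
      have "ae (\<lambda>\<psi>. T \<psi> \<in> D) \<longleftrightarrow> ae (\<lambda>\<psi>. (\<psi> x, \<psi> (e k)) \<in> R k)"
        by (rule ae_cong) (use T1 Tc[OF kK] in \<open>simp add: k(2) cond_def\<close>)
      then show ?thesis using x(2) k(1) by blast
    next
      case False
      then obtain C where C: "C \<in> pull B E L I \<eta>" "D = old C"
        using subsetD[OF G(1) \<open>D \<in> G\<close>] by blast
      have "ae (\<lambda>\<psi>. T \<psi> \<in> D) \<longleftrightarrow> ae (\<lambda>\<psi>. compose I \<psi> \<eta> \<in> C)"
        by (rule ae_cong) (use T1 Tr in \<open>simp add: C(2) old_def\<close>)
      then show ?thesis using C(1) unfolding pull_def ae_def by simp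
    qed
    then have "ae (\<lambda>\<psi>. \<forall>D\<in>G. T \<psi> \<in> D)" by (rule ae_ball[OF G(2)])
    then obtain \<psi> where "\<psi> \<in> E \<rightarrow>\<^sub>E B" "\<forall>D\<in>G. T \<psi> \<in> D" using ae_ex by blast
    then show ?thesis using T1 by blast
  qed
  obtain U where U: "cyl_ultrafilter B ?I U" "?S \<subseteq> U"
    by (rule cyl_ultrafilter_extend[OF cyl S_fip])
  have "pull B E L I \<eta> = projection B ?I U I"
  proof (rule cyl_ultrafilter_eqI)
    show "cyl_ultrafilter B I (pull B E L I \<eta>)"
      unfolding pull_def by (rule cyl_ultrafilter_vimage[OF ultra com comf])
    show "cyl_ultrafilter B I (projection B ?I U I)"
      unfolding projection_def by (rule cyl_ultrafilter_vimage[OF U(1) res resf])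
    show "pull B E L I \<eta> \<subseteq> projection B ?I U I"
      using U(2) unfolding projection_def old_def pull_def by blast
  qed
  then obtain \<eta>' where \<eta>': "\<eta>' \<in> ?I \<rightarrow> E" "\<forall>j\<in>I. \<eta>' j = \<eta> j" "pull B E L ?I \<eta>' = U"
    using exact[unfolded exact_for_def, rule_format, OF I new \<eta>E U(1)] by metis
  have "ae (\<lambda>\<psi>. (\<psi> (\<eta>' {}), \<psi> (e k)) \<in> R k)" if k: "k \<in> K" for k
  proof -
    have kI: "\<iota> k \<in> I" using k unfolding I_def by blast
    have "cond k \<in> pull B E L ?I \<eta>'" using U(2) k unfolding \<eta>'(3) by blast
    then have "ae (\<lambda>\<psi>. compose ?I \<psi> \<eta>' \<in> cond k)" unfolding pull_def ae_def by simp
    then show ?thesis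
    proof (rule ae_mono)
      show "fin_dep B E (\<lambda>\<psi>. (\<psi> (\<eta>' {}), \<psi> (e k)) \<in> R k)"
        by (rule fin_dep_comp2) (use \<eta>'(1) e k in auto)
      show "(\<psi> (\<eta>' {}), \<psi> (e k)) \<in> R k" if "compose ?I \<psi> \<eta>' \<in> cond k" for \<psi>
        using that kI \<eta>'(2) \<eta>\<iota>[OF k] unfolding cond_def compose_def by simp
    qed
  qed
  then show "\<exists>x\<in>E. \<forall>k\<in>K. ae (\<lambda>\<psi>. (\<psi> x, \<psi> (e k)) \<in> R k)" using \<eta>'(1) by blast
qed

end

section \<open>Internal sets\<close>

locale exact_ultrapower = ultrapower B E L \<kappa>
  for B :: "'b set" and E :: "'e set" and L :: "('e \<Rightarrow> 'b) set set" and \<kappa> :: "'k rel" +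
  assumes exact: "exact_for natLeq B E L"
begin

text \<open>
  The range of a representative \<open>f\<close> is the image of \<open>B\<close> under some \<open>g\<close>, and choosing preimages
  turns \<open>f\<close> into a map to \<open>B\<close>, which is almost everywhere a coordinate.
\<close>

lemma star_single_coordinate:
  assumes "x \<in> star \<kappa> B E L X"
  obtains e g where "e \<in> E" "\<And>b. b \<in> B \<Longrightarrow> g b \<in> X" "x = ucls B E L (\<lambda>\<psi>. g (\<psi> e))"
proof -
  obtain f where f: "f \<in> star_maps \<kappa> B E X" "x = ucls B E L f" by (rule starE[OF assms])
  let ?A = "f ` (E \<rightarrow>\<^sub>E B)"
  have "?A \<noteq> {}" using ae_ex[OF ae_all, of "\<lambda>_. True"] by blast
  from card_of_ordLeq2[OF this, THEN iffD2,
      OF fin_dep_card_image[OF infinite_basis star_mapsD(1)[OF f(1)]]]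
  obtain g where g: "g ` B = ?A" by (elim exE)
  have inv: "inv_into B g (f \<psi>) \<in> B" "g (inv_into B g (f \<psi>)) = f \<psi>" if "\<psi> \<in> E \<rightarrow>\<^sub>E B" for \<psi>
    using that g inv_into_into[of "f \<psi>" g B] f_inv_into_f[of "f \<psi>" g B] by auto
  obtain e where e: "e \<in> E" "ae (\<lambda>\<psi>. \<psi> e = inv_into B g (f \<psi>))"
    by (rule coordinate_representation[OF exact fin_dep_comp[OF star_mapsD(1)[OF f(1)], where h = "inv_into B g"] inv(1)])
  have ge: "fin_dep B E (\<lambda>\<psi>. g (\<psi> e))" by (rule fin_dep_comp[OF fin_dep_coord[OF e(1)]])
  show thesis
  proof (rule that[OF e(1)])
    show "g b \<in> X" if "b \<in> B" for b
    proof -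
      have "g b \<in> ?A" using g that by blast
      then show ?thesis by (elim imageE) (simp add: star_mapsD(2)[OF f(1)])
    qed
    have "ae (\<lambda>\<psi>. f \<psi> = g (\<psi> e))"
      by (rule ae_mono[OF e(2) fin_dep_comp2[OF star_mapsD(1)[OF f(1)] ge]]) (use inv(2) in simp)
    then show "x = ucls B E L (\<lambda>\<psi>. g (\<psi> e))"
      unfolding f(2) ucls_eq_iff[OF star_mapsD(1)[OF f(1)] ge] .
  qed
qed

text \<open>
  The data \<open>(e, Q)\<close> through which an internal set \<open>S\<close> becomes an instance of binary saturation:
  its parameter is a single coordinate, and all sets other than \<open>X\<close> have disappeared from \<open>Q\<close>.
\<close>

definition binary_trace ::
  "'a set \<Rightarrow> (('e \<Rightarrow> 'b) \<Rightarrow> 'a) set set \<Rightarrow> 'e \<Rightarrow> ('a \<times> 'b) set \<Rightarrow> bool" where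
  "binary_trace X S e Q \<longleftrightarrow> e \<in> E \<and>
     (\<forall>f. fin_dep B E f \<longrightarrow> (\<forall>\<psi> \<in> E \<rightarrow>\<^sub>E B. f \<psi> \<in> X) \<longrightarrow>
        (ucls B E L f \<in> S \<longleftrightarrow> ae (\<lambda>\<psi>. (f \<psi>, \<psi> e) \<in> Q)))"

lemma binary_traceD:
  assumes "binary_trace X S e Q"
  shows "e \<in> E"
    and "fin_dep B E f \<Longrightarrow> (\<And>\<psi>. \<psi> \<in> E \<rightarrow>\<^sub>E B \<Longrightarrow> f \<psi> \<in> X) \<Longrightarrow>
      ucls B E L f \<in> S \<longleftrightarrow> ae (\<lambda>\<psi>. (f \<psi>, \<psi> e) \<in> Q)"
  using assms unfolding binary_trace_def by blast+

lemma internal_binary: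
  fixes X :: "'a set" and T :: "'y itself"
  assumes "internal \<kappa> B E L T X S"
  shows "\<exists>e Q. binary_trace X S e Q"
proof -
  obtain Y :: "'y set" and R y where y: "y \<in> star \<kappa> B E L Y"
    and S: "S = {x \<in> star \<kappa> B E L X. (x, y) \<in> star_rel2 \<kappa> B E L X Y R}"
    using assms unfolding internal_def by blast
  obtain e g where e: "e \<in> E" "\<And>b. b \<in> B \<Longrightarrow> g b \<in> Y" "y = ucls B E L (\<lambda>\<psi>. g (\<psi> e))"
    by (fact star_single_coordinate[OF y])
  have "binary_trace X S e {(a, b). (a, g b) \<in> R}"
    unfolding binary_trace_def
  proof (intro conjI allI impI)
    show "e \<in> E" by (rule e(1))
    fix f :: "('e \<Rightarrow> 'b) \<Rightarrow> 'a"
    assume f: "fin_dep B E f" and "\<forall>\<psi> \<in> E \<rightarrow>\<^sub>E B. f \<psi> \<in> X"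
    then have fX: "f \<psi> \<in> X" if "\<psi> \<in> E \<rightarrow>\<^sub>E B" for \<psi> using that by blast
    have "ucls B E L f \<in> S \<longleftrightarrow> (ucls B E L f, y) \<in> star_rel2 \<kappa> B E L X Y R"
      unfolding S using ucls_in_star[OF f fX] by simp
    also have "\<dots> \<longleftrightarrow> ae (\<lambda>\<psi>. (f \<psi>, g (\<psi> e)) \<in> R)"
      unfolding e(3)
      by (rule star_rel2_iff[OF f fX fin_dep_comp[OF fin_dep_coord[OF e(1)]]])
        (use e(1,2) in \<open>auto simp: PiE_mem\<close>)
    finally show "ucls B E L f \<in> S \<longleftrightarrow> ae (\<lambda>\<psi>. (f \<psi>, \<psi> e) \<in> {(a, b). (a, g b) \<in> R})" by simp
  qed
  then show ?thesis by blast
qed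

text \<open>
  A surjection \<open>\<gamma>\<close> from \<open>B\<close> onto \<open>X'\<close> translates between coordinates and elements of \<open>*X'\<close>: the
  points in finite intersections become solutions in \<open>E\<close>, and a solution \<open>x\<close> of the whole family
  becomes the point \<open>[\<gamma>(\<psi>\<^sub>x)]\<close>.
\<close>

lemma internal_intersection_core:
  fixes X :: "'a set" and T :: "'y itself"
  assumes int: "\<And>S. S \<in> F \<Longrightarrow> internal \<kappa> B E L T X S"
    and sat: "binary_saturated F"
    and X': "X' \<subseteq> X" "X' \<noteq> {}" "|X'| \<le>o |B|"
    and fip: "\<And>G. G \<subseteq> F \<Longrightarrow> finite G \<Longrightarrow> star \<kappa> B E L X' \<inter> \<Inter>G \<noteq> {}"
  shows "star \<kappa> B E L X \<inter> \<Inter>F \<noteq> {}"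
proof -
  obtain \<gamma> where \<gamma>: "\<gamma> ` B = X'" using card_of_ordLeq2[OF X'(2), THEN iffD2, OF X'(3)] by (elim exE)
  have "\<forall>S\<in>F. \<exists>p. binary_trace X S (fst p) (snd p)"
    using internal_binary[OF int] by simp
  from bchoice[OF this] obtain w where "\<forall>S\<in>F. binary_trace X S (fst (w S)) (snd (w S))" ..
  then obtain e Q where tr: "\<And>S. S \<in> F \<Longrightarrow> binary_trace X S (e S) (Q S)"
    by (auto intro: that[of "\<lambda>S. fst (w S)" "\<lambda>S. snd (w S)"])
  note e = binary_traceD(1)[OF tr] and Q = binary_traceD(2)[OF tr]
  define R where "R S = {(u, v). (\<gamma> u, v) \<in> Q S}" for S
  have "\<exists>x\<in>E. \<forall>S\<in>F. ae (\<lambda>\<psi>. (\<psi> x, \<psi> (e S)) \<in> R S)"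
  proof (rule binary_saturatedD[OF sat e])
    fix G assume G: "G \<subseteq> F" "finite G"
    then obtain z where z: "z \<in> star \<kappa> B E L X'" "\<forall>S\<in>G. z \<in> S" using fip[OF G] by blast
    obtain f where f: "f \<in> star_maps \<kappa> B E X'" "z = ucls B E L f" by (rule starE[OF z(1)])
    note fd = star_mapsD(1)[OF f(1)]
    have inv: "inv_into B \<gamma> (f \<psi>) \<in> B" "\<gamma> (inv_into B \<gamma> (f \<psi>)) = f \<psi>" if "\<psi> \<in> E \<rightarrow>\<^sub>E B" for \<psi>
      using star_mapsD(2)[OF f(1) that] \<gamma> inv_into_into[of "f \<psi>" \<gamma> B] f_inv_into_f[of "f \<psi>" \<gamma> B]
      by auto
    obtain x where x: "x \<in> E" "ae (\<lambda>\<psi>. \<psi> x = inv_into B \<gamma> (f \<psi>))"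
      by (rule coordinate_representation[OF exact fin_dep_comp[OF fd, where h = "inv_into B \<gamma>"] inv(1)])
    have "ae (\<lambda>\<psi>. (\<psi> x, \<psi> (e S)) \<in> R S)" if S: "S \<in> G" for S
    proof -
      have SF: "S \<in> F" using S G(1) by blast
      have fX: "f \<psi> \<in> X" if "\<psi> \<in> E \<rightarrow>\<^sub>E B" for \<psi>
        by (rule subsetD[OF X'(1) star_mapsD(2)[OF f(1) that]])
      have "ae (\<lambda>\<psi>. (f \<psi>, \<psi> (e S)) \<in> Q S)"
        using Q[OF SF fd fX] z(2) S f(2) by simp
      from ae_conj[OF this x(2)] show ?thesis
      proof (rule ae_mono)
        show "fin_dep B E (\<lambda>\<psi>. (\<psi> x, \<psi> (e S)) \<in> R S)"
          by (rule fin_dep_comp2) (use x(1) e[OF SF] in auto)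
        show "(\<psi> x, \<psi> (e S)) \<in> R S" if "\<psi> \<in> E \<rightarrow>\<^sub>E B"
          "(f \<psi>, \<psi> (e S)) \<in> Q S \<and> \<psi> x = inv_into B \<gamma> (f \<psi>)" for \<psi>
          using that(2) inv(2)[OF that(1)] unfolding R_def by simp
      qed
    qed
    then show "\<exists>x\<in>E. \<forall>S\<in>G. ae (\<lambda>\<psi>. (\<psi> x, \<psi> (e S)) \<in> R S)" using x(1) by blast
  qed
  then obtain x where x: "x \<in> E" "\<And>S. S \<in> F \<Longrightarrow> ae (\<lambda>\<psi>. (\<psi> x, \<psi> (e S)) \<in> R S)" by blast
  have fd: "fin_dep B E (\<lambda>\<psi>. \<gamma> (\<psi> x))" by (rule fin_dep_comp[OF fin_dep_coord[OF x(1)]])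
  have inX: "\<gamma> (\<psi> x) \<in> X" if "\<psi> \<in> E \<rightarrow>\<^sub>E B" for \<psi>
    using \<gamma> X'(1) PiE_mem[OF that x(1)] by blast
  have "ucls B E L (\<lambda>\<psi>. \<gamma> (\<psi> x)) \<in> S" if S: "S \<in> F" for S
  proof -
    have "ucls B E L (\<lambda>\<psi>. \<gamma> (\<psi> x)) \<in> S \<longleftrightarrow> ae (\<lambda>\<psi>. (\<gamma> (\<psi> x), \<psi> (e S)) \<in> Q S)"
      by (rule Q[OF S fd]) (rule inX)
    then show ?thesis using x(2)[OF S] unfolding R_def by simp
  qed
  moreover have "ucls B E L (\<lambda>\<psi>. \<gamma> (\<psi> x)) \<in> star \<kappa> B E L X"
    by (rule ucls_in_star[OF fd]) (rule inX)
  ultimately show ?thesis by blast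
qed

text \<open>
  As the family has at most \<open>|B|\<close> finite subfamilies, points chosen in their intersections lie in
  \<open>*X'\<close> for a common \<open>X'\<close> of cardinality at most \<open>|B|\<close>.
\<close>

lemma internal_intersection_any_set:
  fixes X :: "'a set" and T :: "'y itself"
  assumes "\<And>F :: (('e \<Rightarrow> 'b) \<Rightarrow> 'a) set set set. |F| <o m \<Longrightarrow> |F| \<le>o |B| \<and> binary_saturated F"
  shows "internal_intersection m \<kappa> B E L T X"
  unfolding internal_intersection_def
proof (intro allI impI)
  fix F assume F: "F \<subseteq> {S. internal \<kappa> B E L T X S}" "|F| <o m"
    and fip: "\<forall>G\<subseteq>F. finite G \<longrightarrow> star \<kappa> B E L X \<inter> \<Inter>G \<noteq> {}"
  let ?Fin = "{G. G \<subseteq> F \<and> finite G}"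
  have "\<exists>A. A \<subseteq> X \<and> |A| \<le>o |B| \<and> star \<kappa> B E L A \<inter> \<Inter>G \<noteq> {}" if "G \<in> ?Fin" for G
  proof -
    have "star \<kappa> B E L X \<inter> \<Inter>G \<noteq> {}" using fip that by simp
    then obtain z where z: "z \<in> star \<kappa> B E L X" "z \<in> \<Inter>G" by blast
    obtain A where "A \<subseteq> X" "|A| \<le>o |B|" "z \<in> star \<kappa> B E L A"
      by (rule star_confinement[OF z(1)])
    then show ?thesis using z(2) by (intro exI[of _ A]) auto
  qed
  then have "\<forall>G\<in>?Fin. \<exists>A. A \<subseteq> X \<and> |A| \<le>o |B| \<and> star \<kappa> B E L A \<inter> \<Inter>G \<noteq> {}" by (rule ballI)
  from bchoice[OF this] obtain A where
    A: "\<forall>G\<in>?Fin. A G \<subseteq> X \<and> |A G| \<le>o |B| \<and> star \<kappa> B E L (A G) \<inter> \<Inter>G \<noteq> {}" ..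
  let ?X' = "\<Union>G\<in>?Fin. A G"
  show "star \<kappa> B E L X \<inter> \<Inter>F \<noteq> {}"
  proof (rule internal_intersection_core)
    show "internal \<kappa> B E L T X S" if "S \<in> F" for S using F(1) that by blast
    show "binary_saturated F" using assms F(2) by blast
    show "?X' \<subseteq> X"
    proof (rule UN_least)
      show "A G \<subseteq> X" if "G \<in> ?Fin" for G using bspec[OF A that] by (elim conjE)
    qed
    have "|F| \<le>o |B|" using assms F(2) by blast
    moreover have "\<forall>G\<in>?Fin. |A G| \<le>o |B|"
    proof
      show "|A G| \<le>o |B|" if "G \<in> ?Fin" for G using bspec[OF A that] by (elim conjE)
    qed
    ultimately show "|?X'| \<le>o |B|"
      by (intro card_of_UNION_ordLeq_infinite[OF infinite_basis finite_subsets_card[OF infinite_basis]])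
    have sub: "star \<kappa> B E L (A G) \<subseteq> star \<kappa> B E L ?X'" if "G \<in> ?Fin" for G
      by (rule star_mono) (use that in blast)
    show "star \<kappa> B E L ?X' \<inter> \<Inter>G \<noteq> {}" if "G \<subseteq> F" "finite G" for G
    proof -
      have G: "G \<in> ?Fin" using that by simp
      have "star \<kappa> B E L (A G) \<inter> \<Inter>G \<noteq> {}" using bspec[OF A G] by (elim conjE)
      then show ?thesis using sub[OF G] by blast
    qed
    from this[of "{}"] obtain z where "z \<in> star \<kappa> B E L ?X'" by auto
    then obtain f where f: "f \<in> star_maps \<kappa> B E ?X'" by (rule starE)
    obtain \<psi> where "\<psi> \<in> E \<rightarrow>\<^sub>E B" using ae_ex[OF ae_all, of "\<lambda>_. True"] by blast
    from star_mapsD(2)[OF f this] show "?X' \<noteq> {}" by blast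
  qed
qed

lemma internal_intersection_small_set:
  fixes X :: "'a set" and T :: "'y itself"
  assumes "\<And>F :: (('e \<Rightarrow> 'b) \<Rightarrow> 'a) set set set. |F| <o m \<Longrightarrow> binary_saturated F"
    and X: "|X| \<le>o |B|"
  shows "internal_intersection m \<kappa> B E L T X"
  unfolding internal_intersection_def
proof (intro allI impI)
  fix F assume F: "F \<subseteq> {S. internal \<kappa> B E L T X S}" "|F| <o m"
    and fip: "\<forall>G\<subseteq>F. finite G \<longrightarrow> star \<kappa> B E L X \<inter> \<Inter>G \<noteq> {}"
  show "star \<kappa> B E L X \<inter> \<Inter>F \<noteq> {}"
  proof (rule internal_intersection_core[OF _ _ subset_refl _ X])
    show "internal \<kappa> B E L T X S" if "S \<in> F" for S using F(1) that by blast
    show "binary_saturated F" using assms(1) F(2) by blast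
    show "star \<kappa> B E L X \<inter> \<Inter>G \<noteq> {}" if "G \<subseteq> F" "finite G" for G using fip that by simp
    from this[of "{}"] obtain z where "z \<in> star \<kappa> B E L X" by auto
    then obtain f where f: "f \<in> star_maps \<kappa> B E X" by (rule starE)
    obtain \<psi> where "\<psi> \<in> E \<rightarrow>\<^sub>E B" using ae_ex[OF ae_all, of "\<lambda>_. True"] by blast
    from star_mapsD(2)[OF f this] show "X \<noteq> {}" by blast
  qed
qed

section \<open>The cardinality of the ultrapower\<close>

lemma card_star_le:
  assumes E: "|E| \<le>o |Pow (Pow B)|" and X: "|X| \<le>o |Pow (Pow B)|"
  shows "|star \<kappa> B E L X| \<le>o |Pow (Pow B)|"
proof -
  let ?h = "\<lambda>(e, g). ucls B E L (\<lambda>\<psi>. g (\<psi> e))"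
  have "star \<kappa> B E L X \<subseteq> ?h ` (E \<times> (B \<rightarrow>\<^sub>E X))"
  proof
    fix x assume x: "x \<in> star \<kappa> B E L X"
    obtain e g where e: "e \<in> E" "\<And>b. b \<in> B \<Longrightarrow> g b \<in> X" "x = ucls B E L (\<lambda>\<psi>. g (\<psi> e))"
      by (fact star_single_coordinate[OF x])
    have rep: "x = ucls B E L (\<lambda>\<psi>. restrict g B (\<psi> e))"
      unfolding e(3)
    proof (subst ucls_eq_iff)
      show "ae (\<lambda>\<psi>. g (\<psi> e) = restrict g B (\<psi> e))"
        by (rule ae_all) (use e(1) in \<open>auto simp: PiE_mem\<close>)
    qed (use e(1) in \<open>auto intro!: fin_dep_comp[OF fin_dep_coord]\<close>)
    show "x \<in> ?h ` (E \<times> (B \<rightarrow>\<^sub>E X))"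
    proof (rule image_eqI)
      show "x = ?h (e, restrict g B)" unfolding prod.case by (rule rep)
      show "(e, restrict g B) \<in> E \<times> (B \<rightarrow>\<^sub>E X)" using e(1,2) by auto
    qed
  qed
  moreover have "|E \<times> (B \<rightarrow>\<^sub>E X)| \<le>o |Pow (Pow B)|"
    by (rule card_of_Times_ordLeq_infinite_Field[OF _ E card_functions_le[OF infinite_basis X] card_of_Card_order])
      (simp add: Field_card_of infinite_basis finite_Pow_iff)
  ultimately show ?thesis by (rule ordLeq_transitive[OF surj_imp_ordLeq])
qed

text \<open>
  Saturation is used twice. If \<open>*N\<close>, for \<open>N\<close> the range of \<open>a\<close>, had at most \<open>2\<^sup>b\<close> elements, the
  conditions of being different from each of them would have a solution in \<open>*N\<close>. So \<open>*N\<close> contains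
  a family of distinct elements indexed by \<open>Pow B\<close>. For every set \<open>S\<close> of indices there is then an
  element of \<open>*N\<close> whose binary digits are \<open>1\<close> at the members of the family with index in \<open>S\<close> and
  \<open>0\<close> at the others; different \<open>S\<close> have different codes.
\<close>

lemma card_star_countable_ge:
  fixes a :: "nat \<Rightarrow> 'a"
  assumes reg: "exact_for (cardSuc |Pow B| ) B E L" and a: "inj a"
  shows "|Pow (Pow B)| \<le>o |star \<kappa> B E L (range a)|"
proof -
  let ?N = "star \<kappa> B E L (range a)"
  have "|UNIV :: nat set| \<le>o |B|" using infinite_basis infinite_iff_card_of_nat by blast
  from card_of_ordLeq2[OF UNIV_not_empty, THEN iffD2, OF this]
  obtain d :: "'b \<Rightarrow> nat" where d: "d ` B = UNIV" by (elim exE)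
  \<comment> \<open>A coordinate \<open>e\<close> is read as the nonstandard number \<open>d(\<psi>\<^sub>e)\<close>, or as the element \<open>pt e\<close> of \<open>*N\<close>.\<close>
  define c where "c x = a (d x)" for x
  have c_eq: "c x = c y \<longleftrightarrow> d x = d y" for x y unfolding c_def using a by (simp add: inj_eq)
  define pt where "pt e = ucls B E L (\<lambda>\<psi>. c (\<psi> e))" for e
  have cfd: "fin_dep B E (\<lambda>\<psi>. c (\<psi> e))" if "e \<in> E" for e by (rule fin_dep_comp[OF fin_dep_coord[OF that]])
  have dfd: "fin_dep B E (\<lambda>\<psi>. d (\<psi> e))" if "e \<in> E" for e by (rule fin_dep_comp[OF fin_dep_coord[OF that]])
  have pt_in: "pt e \<in> ?N" if "e \<in> E" for e
    unfolding pt_def by (rule ucls_in_star[OF cfd[OF that]]) (simp add: c_def)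
  have pt_eq: "pt e = pt e' \<longleftrightarrow> ae (\<lambda>\<psi>. d (\<psi> e) = d (\<psi> e'))" if "e \<in> E" "e' \<in> E" for e e'
    unfolding pt_def ucls_eq_iff[OF cfd[OF that(1)] cfd[OF that(2)]] c_eq ..
  have pt_neq: "pt e \<noteq> pt e' \<longleftrightarrow> ae (\<lambda>\<psi>. d (\<psi> e) \<noteq> d (\<psi> e'))" if "e \<in> E" "e' \<in> E" for e e'
    unfolding pt_eq[OF that] by (rule ae_not[OF fin_dep_comp2[OF dfd dfd, OF that], symmetric])
  have pt_surj: "\<exists>e. e \<in> E \<and> x = pt e" if x: "x \<in> ?N" for x
  proof -
    obtain f where f: "f \<in> star_maps \<kappa> B E (range a)" "x = ucls B E L f" by (rule starE[OF x])
    note fd = star_mapsD(1)[OF f(1)]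
    have inv: "inv_into B c (f \<psi>) \<in> B" "c (inv_into B c (f \<psi>)) = f \<psi>" if "\<psi> \<in> E \<rightarrow>\<^sub>E B" for \<psi>
    proof -
      have "c ` B = range a" using d unfolding c_def by (metis image_image)
      then have "f \<psi> \<in> c ` B" using star_mapsD(2)[OF f(1) that] by simp
      then show "inv_into B c (f \<psi>) \<in> B" "c (inv_into B c (f \<psi>)) = f \<psi>"
        by (rule inv_into_into, rule f_inv_into_f)
    qed
    obtain e where e: "e \<in> E" "ae (\<lambda>\<psi>. \<psi> e = inv_into B c (f \<psi>))"
      by (rule coordinate_representation[OF exact fin_dep_comp[OF fd, where h = "inv_into B c"] inv(1)])
    have "ae (\<lambda>\<psi>. f \<psi> = c (\<psi> e))"
      by (rule ae_mono[OF e(2) fin_dep_comp2[OF fd cfd[OF e(1)]]]) (use inv(2) in simp)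
    then have "x = pt e" unfolding pt_def f(2) ucls_eq_iff[OF fd cfd[OF e(1)]] .
    then show ?thesis using e(1) by blast
  qed
  then obtain rp where rp: "\<And>x. x \<in> ?N \<Longrightarrow> rp x \<in> E" "\<And>x. x \<in> ?N \<Longrightarrow> x = pt (rp x)" by metis
  have solve: "\<exists>x\<in>E. ae (\<lambda>\<psi>. d (\<psi> x) = f \<psi>)" if f: "fin_dep B E f" for f
  proof -
    have inv: "inv_into B d n \<in> B" "d (inv_into B d n) = n" for n
      using d inv_into_into[of n d B] f_inv_into_f[of n d B] by auto
    obtain e where e: "e \<in> E" "ae (\<lambda>\<psi>. \<psi> e = inv_into B d (f \<psi>))"
      by (rule coordinate_representation[OF exact fin_dep_comp[OF f, where h = "inv_into B d"] inv(1)])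
    have "ae (\<lambda>\<psi>. d (\<psi> e) = f \<psi>)"
      by (rule ae_mono[OF e(2) fin_dep_comp2[OF dfd[OF e(1)] f]]) (use inv(2) in simp)
    then show ?thesis using e(1) by blast
  qed
  have "\<not> |?N| \<le>o |Pow B|"
  proof
    assume "|?N| \<le>o |Pow B|"
    from exact_imp_binary_saturated[OF reg this]
    have "\<exists>x\<in>E. \<forall>y\<in>?N. ae (\<lambda>\<psi>. (\<psi> x, \<psi> (rp y)) \<in> {(u, v). d u \<noteq> d v})"
    proof (rule binary_saturatedD[where e = rp and R = "\<lambda>_. {(u, v). d u \<noteq> d v}", OF _ rp(1)])
      fix G assume G: "G \<subseteq> ?N" "finite G"
      define f where "f \<psi> = (SOME n. n \<notin> (restrict (\<lambda>y. d (\<psi> (rp y))) G) ` G)" for \<psi>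
      have f: "fin_dep B E f"
        unfolding f_def by (rule fin_dep_comp[OF fin_dep_family[OF G(2) dfd]]) (use rp(1) G(1) in blast)
      have new: "f \<psi> \<noteq> d (\<psi> (rp y))" if "y \<in> G" for \<psi> y
      proof -
        have "\<exists>n. n \<notin> (restrict (\<lambda>y. d (\<psi> (rp y))) G) ` G"
          using G(2) infinite_UNIV_nat by (intro ex_new_if_finite) auto
        from someI_ex[OF this] have "f \<psi> \<notin> (restrict (\<lambda>y. d (\<psi> (rp y))) G) ` G" unfolding f_def .
        then show ?thesis using that by auto
      qed
      obtain x where x: "x \<in> E" "ae (\<lambda>\<psi>. d (\<psi> x) = f \<psi>)" using solve[OF f] by blast
      have "ae (\<lambda>\<psi>. (\<psi> x, \<psi> (rp y)) \<in> {(u, v). d u \<noteq> d v})" if y: "y \<in> G" for y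
      proof (rule ae_mono[OF x(2)])
        show "fin_dep B E (\<lambda>\<psi>. (\<psi> x, \<psi> (rp y)) \<in> {(u, v). d u \<noteq> d v})"
          by (rule fin_dep_comp2) (use x(1) rp(1) G(1) y in auto)
      qed (use new[OF y] in simp)
      then show "\<exists>x\<in>E. \<forall>y\<in>G. ae (\<lambda>\<psi>. (\<psi> x, \<psi> (rp y)) \<in> {(u, v). d u \<noteq> d v})" using x(1) by blast
    qed
    then obtain x where x: "x \<in> E"
      "\<And>y. y \<in> ?N \<Longrightarrow> ae (\<lambda>\<psi>. (\<psi> x, \<psi> (rp y)) \<in> {(u, v). d u \<noteq> d v})" by blast
    have "ae (\<lambda>\<psi>. d (\<psi> x) \<noteq> d (\<psi> (rp (pt x))))" using x(2)[OF pt_in[OF x(1)]] by simp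
    then have "pt x \<noteq> pt (rp (pt x))" using pt_neq[OF x(1) rp(1)[OF pt_in[OF x(1)]]] by simp
    then show False using rp(2)[OF pt_in[OF x(1)]] by simp
  qed
  then have "|Pow B| \<le>o |?N|" using ordLeq_total[OF card_of_Well_order card_of_Well_order] by blast
  from card_of_ordLeq[THEN iffD2, OF this]
  obtain h where h: "inj_on h (Pow B)" "h ` Pow B \<subseteq> ?N" by (elim exE conjE)
  define e where "e s = rp (h s)" for s
  have e: "e s \<in> E" if "s \<in> Pow B" for s using rp(1) h(2) that unfolding e_def by blast
  have e_neq: "ae (\<lambda>\<psi>. d (\<psi> (e s)) \<noteq> d (\<psi> (e t)))" if "s \<in> Pow B" "t \<in> Pow B" "s \<noteq> t" for s t
  proof -
    have "h s \<noteq> h t" using h(1) that unfolding inj_on_def by blast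
    moreover have "h s = pt (e s)" "h t = pt (e t)" using rp(2) h(2) that(1,2) unfolding e_def by blast+
    ultimately show ?thesis using pt_neq[OF e[OF that(1)] e[OF that(2)]] by simp
  qed
  define R where "R S s = {(u, v). (d v \<in> set_decode (d u)) = (s \<in> S)}" for S and s :: "'b set"
  have "\<exists>x\<in>E. \<forall>s\<in>Pow B. ae (\<lambda>\<psi>. (\<psi> x, \<psi> (e s)) \<in> R S s)" for S
    using exact_imp_binary_saturated[OF reg ordLeq_refl[OF card_of_Card_order]]
    proof (rule binary_saturatedD[where e = e and R = "R S", OF _ e])
      fix G assume G: "G \<subseteq> Pow B" "finite G"
      define f where "f \<psi> = set_encode ((restrict (\<lambda>s. d (\<psi> (e s))) G) ` (G \<inter> S))" for \<psi>
      have f: "fin_dep B E f"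
        unfolding f_def by (rule fin_dep_comp[OF fin_dep_family[OF G(2) dfd]]) (use e G(1) in blast)
      obtain x where x: "x \<in> E" "ae (\<lambda>\<psi>. d (\<psi> x) = f \<psi>)" using solve[OF f] by blast
      have "ae (\<lambda>\<psi>. (\<psi> x, \<psi> (e s)) \<in> R S s)" if s: "s \<in> G" for s
      proof -
        \<comment> \<open>Where two members of the family take the same value, the digit there could be wrong.\<close>
        have "ae (\<lambda>\<psi>. \<forall>t\<in>G - {s}. d (\<psi> (e s)) \<noteq> d (\<psi> (e t)))"
        proof (rule ae_ball)
          show "ae (\<lambda>\<psi>. d (\<psi> (e s)) \<noteq> d (\<psi> (e t)))" if "t \<in> G - {s}" for t
            by (rule e_neq) (use G(1) s that in blast)+
        qed (use G(2) in simp)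
        from ae_conj[OF x(2) this] show ?thesis
        proof (rule ae_mono)
          show "fin_dep B E (\<lambda>\<psi>. (\<psi> x, \<psi> (e s)) \<in> R S s)"
            by (rule fin_dep_comp2) (use x(1) e G(1) s in auto)
          fix \<psi> assume *: "d (\<psi> x) = f \<psi> \<and> (\<forall>t\<in>G - {s}. d (\<psi> (e s)) \<noteq> d (\<psi> (e t)))"
          have "set_decode (d (\<psi> x)) = (\<lambda>s. d (\<psi> (e s))) ` (G \<inter> S)"
            using * G(2) unfolding f_def by (simp add: set_encode_inverse)
          moreover have "d (\<psi> (e s)) \<in> (\<lambda>s. d (\<psi> (e s))) ` (G \<inter> S) \<longleftrightarrow> s \<in> S"
          proof
            assume "d (\<psi> (e s)) \<in> (\<lambda>s. d (\<psi> (e s))) ` (G \<inter> S)"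
            then obtain t where t: "t \<in> G \<inter> S" "d (\<psi> (e s)) = d (\<psi> (e t))" by (elim imageE)
            then have "t = s" using * by blast
            then show "s \<in> S" using t(1) by simp
          qed (use s in simp)
          ultimately have "d (\<psi> (e s)) \<in> set_decode (d (\<psi> x)) \<longleftrightarrow> s \<in> S" by simp
          then show "(\<psi> x, \<psi> (e s)) \<in> R S s" unfolding R_def by simp
        qed
      qed
      then show "\<exists>x\<in>E. \<forall>s\<in>G. ae (\<lambda>\<psi>. (\<psi> x, \<psi> (e s)) \<in> R S s)" using x(1) by blast
    qed
  then have "\<forall>S. \<exists>x. x \<in> E \<and> (\<forall>s\<in>Pow B. ae (\<lambda>\<psi>. (\<psi> x, \<psi> (e s)) \<in> R S s))" by blast
  from choice[OF this] obtain code where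
    "\<forall>S. code S \<in> E \<and> (\<forall>s\<in>Pow B. ae (\<lambda>\<psi>. (\<psi> (code S), \<psi> (e s)) \<in> R S s))" ..
  then have code: "code S \<in> E" "s \<in> Pow B \<Longrightarrow> ae (\<lambda>\<psi>. (\<psi> (code S), \<psi> (e s)) \<in> R S s)"
    for S s by blast+
  have "inj_on (\<lambda>S. pt (code S)) (Pow (Pow B))"
  proof (rule inj_onI, rule ccontr)
    fix S S' assume S: "S \<in> Pow (Pow B)" "S' \<in> Pow (Pow B)"
      and eq: "pt (code S) = pt (code S')" and neq: "S \<noteq> S'"
    obtain s where s': "(s \<in> S) \<noteq> (s \<in> S')" using neq by (auto simp: set_eq_iff)
    moreover have "s \<in> Pow B" using s' S by (cases "s \<in> S") auto
    ultimately have s: "s \<in> Pow B" "(s \<in> S) \<noteq> (s \<in> S')" by simp_all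
    have "ae (\<lambda>\<psi>. d (\<psi> (code S)) = d (\<psi> (code S')))" using eq pt_eq[OF code(1) code(1)] by simp
    from ae_ex[OF ae_conj[OF this ae_conj[OF code(2)[OF s(1), of S] code(2)[OF s(1), of S']]]]
    obtain \<psi> where "d (\<psi> (code S)) = d (\<psi> (code S'))"
      "(\<psi> (code S), \<psi> (e s)) \<in> R S s" "(\<psi> (code S'), \<psi> (e s)) \<in> R S' s"
      by (elim bexE conjE)
    then show False using s(2) unfolding R_def by simp
  qed
  moreover have "(\<lambda>S. pt (code S)) ` Pow (Pow B) \<subseteq> ?N" using pt_in code(1) by blast
  ultimately show ?thesis by (rule card_of_ordLeq[THEN iffD1, OF exI, OF conjI])
qed

lemma card_star_eq:
  fixes a :: "nat \<Rightarrow> 'a"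
  assumes reg: "regular_lim_rim B E L" and a: "inj a" and X: "|X| \<le>o |Pow (Pow B)|"
    and D: "star \<kappa> B E L (range a) \<subseteq> D" "D \<subseteq> star \<kappa> B E L X"
  shows "|D| =o |Pow (Pow B)|"
proof -
  have E: "|E| \<le>o |Pow (Pow B)|" and ex: "exact_for (cardSuc |Pow B| ) B E L"
    using reg unfolding regular_lim_rim_def by (simp_all add: ordIso_imp_ordLeq)
  have "|D| \<le>o |Pow (Pow B)|"
    by (rule ordLeq_transitive[OF card_of_mono1[OF D(2)] card_star_le[OF E X]])
  moreover have "|Pow (Pow B)| \<le>o |D|"
    by (rule ordLeq_transitive[OF card_star_countable_ge[OF ex a] card_of_mono1[OF D(1)]])
  ultimately show ?thesis by (simp add: ordIso_iff_ordLeq)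
qed

lemma confined_range:
  fixes a :: "nat \<Rightarrow> 'a"
  assumes "natLeq <o m" "x \<in> star \<kappa> B E L (range a)"
  shows "confined m \<kappa> B E L x"
proof -
  have le: "|range a| \<le>o natLeq"
    by (rule ordLeq_ordIso_trans[OF card_of_image card_of_nat])
  have "natLeq \<le>o |B|" using infinite_basis infinite_iff_natLeq_ordLeq by blast
  then have "is_set \<kappa> (range a)"
    unfolding is_set_def by (rule ordLeq_ordLess_trans[OF ordLeq_transitive[OF le] basis_is_set])
  then show ?thesis
    unfolding confined_def using ordLeq_ordLess_trans[OF le assms(1)] assms(2) by blast
qed

corollary card_star_confined_eq:
  fixes a :: "nat \<Rightarrow> 'a"
  assumes "regular_lim_rim B E L" and "inj a" "range a \<subseteq> X" and "|X| \<le>o |Pow (Pow B)|"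
    and m: "natLeq <o m"
  shows "|{x \<in> star \<kappa> B E L X. confined m \<kappa> B E L x}| =o |Pow (Pow B)|"
  by (rule card_star_eq[OF assms(1,2,4)])
    (use star_mono[OF assms(3)] confined_range[OF m] in auto)

end

section \<open>The theorem\<close>

lemma card_less_cardSuc: "|F| <o cardSuc |A| \<Longrightarrow> |F| \<le>o |A|"
  unfolding cardSuc_ordLeq_ordLess[OF card_of_Card_order card_of_Card_order] .

theorem mainTheorem5:
  fixes B :: "'b set" and E :: "'e set" and L :: "('e \<Rightarrow> 'b) set set" and \<kappa> :: "'k rel"
  assumes "infinite B"
    and "exact_lim_rim B E L"
    and "Card_order \<kappa>" and "|B| <o \<kappa>"
  shows
    "(\<forall>(X :: 's \<Rightarrow> 'a set) (ar :: 'r \<Rightarrow> 's list) P p.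
        (\<forall>r. P r \<subseteq> {xs. list_all2 (\<lambda>x s. x \<in> X s) xs (ar r)}) \<longrightarrow>
        sentence ar p \<longrightarrow> true_in X P p \<longrightarrow>
        true_in (\<lambda>s. star \<kappa> B E L (X s)) (\<lambda>r. star_rel \<kappa> B E L (map X (ar r)) (P r)) p)
     \<and>
     (\<forall>X :: 'a set. \<forall>x \<in> star \<kappa> B E L X.
        \<exists>A \<subseteq> X. is_set \<kappa> A \<and> |A| \<le>o |B| \<and> x \<in> star \<kappa> B E L A)
     \<and>
     (\<forall>m :: 'm rel. Card_order m \<longrightarrow> m \<le>o cardSuc |B| \<longrightarrow> saturated_for m B E L \<longrightarrow>
        (\<forall>X :: 'a set. internal_intersection m \<kappa> B E L TYPE('y) X))
     \<and>
     (regular_lim_rim B E L \<longrightarrow>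
        (\<forall>X :: 'a set. internal_intersection (cardSuc |B| ) \<kappa> B E L TYPE('y) X) \<and>
        (\<forall>X :: 'a set. is_set \<kappa> X \<longrightarrow> |X| \<le>o |B| \<longrightarrow>
           internal_intersection (cardSuc |Pow B| ) \<kappa> B E L TYPE('y) X))
     \<and>
     (regular_lim_rim B E L \<longrightarrow>
        (\<forall>X :: 'a set. is_set \<kappa> X \<longrightarrow> infinite X \<longrightarrow> |X| \<le>o |Pow (Pow B)| \<longrightarrow>
           |star \<kappa> B E L X| =o |Pow (Pow B)| \<and>
           (\<forall>b' :: 'c rel. Cinfinite b' \<longrightarrow> b' <o |B| \<longrightarrow>
              |{x \<in> star \<kappa> B E L X. confined (cardSuc b') \<kappa> B E L x}| =o |Pow (Pow B)| \<and>
              (natLeq <o b' \<longrightarrow>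
                 |{x \<in> star \<kappa> B E L X. confined b' \<kappa> B E L x}| =o |Pow (Pow B)| ))))"
proof -
  have lim: "lim_rim B E L" and ex: "exact_for natLeq B E L"
    using assms(2) unfolding exact_lim_rim_def by simp_all
  interpret exact_ultrapower B E L \<kappa>
    by unfold_locales (use assms(1,4) lim ex in \<open>simp_all add: lim_rim_def\<close>)
  have a: "true_in (\<lambda>s. star \<kappa> B E L (X s)) (\<lambda>r. star_rel \<kappa> B E L (map X (ar r)) (P r)) p"
    if "sentence ar p" "true_in X P p"
    for X :: "'s \<Rightarrow> 'a set" and ar :: "'r \<Rightarrow> 's list" and P p
    by (rule transfer_principle[OF that])
  have b: "\<exists>A \<subseteq> X. is_set \<kappa> A \<and> |A| \<le>o |B| \<and> x \<in> star \<kappa> B E L A"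
    if x: "x \<in> star \<kappa> B E L X" for X :: "'a set" and x
  proof -
    obtain A where "A \<subseteq> X" "is_set \<kappa> A" "|A| \<le>o |B|" "x \<in> star \<kappa> B E L A"
      by (rule star_confinement[OF x])
    then show ?thesis by (intro exI[of _ A] conjI)
  qed
  have c: "internal_intersection m \<kappa> B E L TYPE('y) X"
    if m: "m \<le>o cardSuc |B|" "saturated_for m B E L" for m :: "'m rel" and X :: "'a set"
  proof (rule internal_intersection_any_set)
    fix F :: "(('e \<Rightarrow> 'b) \<Rightarrow> 'a) set set set" assume F: "|F| <o m"
    show "|F| \<le>o |B| \<and> binary_saturated F"
      by (rule conjI[OF card_less_cardSuc[OF ordLess_ordLeq_trans[OF F m(1)]]
            saturated_imp_binary_saturated[OF m(2) F]])
  qed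
  have d1: "internal_intersection (cardSuc |B| ) \<kappa> B E L TYPE('y) X"
    if reg: "regular_lim_rim B E L" for X :: "'a set"
  proof (rule internal_intersection_any_set)
    fix F :: "(('e \<Rightarrow> 'b) \<Rightarrow> 'a) set set set" assume "|F| <o cardSuc |B|"
    then have F: "|F| \<le>o |B|" by (rule card_less_cardSuc)
    have "exact_for (cardSuc |Pow B| ) B E L" using reg unfolding regular_lim_rim_def by simp
    from exact_imp_binary_saturated[OF this
        ordLeq_transitive[OF F ordLess_imp_ordLeq[OF card_of_Pow]]]
    show "|F| \<le>o |B| \<and> binary_saturated F" using F by (intro conjI)
  qed
  have d2: "internal_intersection (cardSuc |Pow B| ) \<kappa> B E L TYPE('y) X"
    if reg: "regular_lim_rim B E L" and X: "|X| \<le>o |B|" for X :: "'a set"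
  proof (rule internal_intersection_small_set[OF _ X])
    fix F :: "(('e \<Rightarrow> 'b) \<Rightarrow> 'a) set set set" assume F: "|F| <o cardSuc |Pow B|"
    have "exact_for (cardSuc |Pow B| ) B E L" using reg unfolding regular_lim_rim_def by simp
    from exact_imp_binary_saturated[OF this card_less_cardSuc[OF F]] show "binary_saturated F" .
  qed
  have e: "|star \<kappa> B E L X| =o |Pow (Pow B)| \<and>
      (\<forall>b' :: 'c rel. Cinfinite b' \<longrightarrow> b' <o |B| \<longrightarrow>
         |{x \<in> star \<kappa> B E L X. confined (cardSuc b') \<kappa> B E L x}| =o |Pow (Pow B)| \<and>
         (natLeq <o b' \<longrightarrow>
            |{x \<in> star \<kappa> B E L X. confined b' \<kappa> B E L x}| =o |Pow (Pow B)| ))"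
    if reg: "regular_lim_rim B E L" and inf: "infinite X" and X: "|X| \<le>o |Pow (Pow B)|"
    for X :: "'a set"
  proof -
    obtain a :: "nat \<Rightarrow> 'a" where a: "inj a" "range a \<subseteq> X"
      using infinite_countable_subset[OF inf] by blast
    note sub = star_mono[OF a(2)]
    note conf = card_star_confined_eq[OF reg a X]
    have less: "natLeq <o cardSuc b'" if "Cinfinite b'" for b' :: "'c rel"
      by (rule ordLeq_ordLess_trans[OF natLeq_ordLeq_cinfinite[OF that]
            cardSuc_greater[OF conjunct2[OF that]]])
    show ?thesis
    proof (intro conjI[OF card_star_eq[OF reg a(1) X sub subset_refl]] allI impI)
      fix b' :: "'c rel" assume "Cinfinite b'"
      from conf[OF less[OF this]]
      show "|{x \<in> star \<kappa> B E L X. confined (cardSuc b') \<kappa> B E L x}| =o |Pow (Pow B)| \<and>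
          (natLeq <o b' \<longrightarrow>
             |{x \<in> star \<kappa> B E L X. confined b' \<kappa> B E L x}| =o |Pow (Pow B)| )"
        using conf[of b'] by (intro conjI impI)
    qed
  qed
  show ?thesis
  proof (intro conjI)
    show "\<forall>m :: 'm rel. Card_order m \<longrightarrow> m \<le>o cardSuc |B| \<longrightarrow> saturated_for m B E L \<longrightarrow>
        (\<forall>X :: 'a set. internal_intersection m \<kappa> B E L TYPE('y) X)"
      by (intro allI impI c)
    show "regular_lim_rim B E L \<longrightarrow>
        (\<forall>X :: 'a set. internal_intersection (cardSuc |B| ) \<kappa> B E L TYPE('y) X) \<and>
        (\<forall>X :: 'a set. is_set \<kappa> X \<longrightarrow> |X| \<le>o |B| \<longrightarrow>
           internal_intersection (cardSuc |Pow B| ) \<kappa> B E L TYPE('y) X)"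
      by (intro allI impI conjI d1 d2)
  qed (intro allI impI ballI a b e; assumption)+
qed

end
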